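(* Let $n\ge1$. The differential subalgebra $\mathrm{Fun}(\mathrm{Op}_{n|1}(D))$ of $\pi^0_{\mathfrak h}$ is a Poisson vertex subalgebra of $\pi^0_{\mathfrak h}$ with its standard Poisson vertex algebra structure. Consequently, $\mathfrak z(V^{\kappa_c}(\mathfrak{gl}_{n|1}))$ inherits a Poisson vertex algebra structure through the affine Harish-Chandra isomorphism $\widehat\iota_{\mathrm{HC}}:\mathfrak z(V^{\kappa_c}(\mathfrak{gl}_{n|1}))\xrightarrow{\simeq}\mathrm{Fun}(\mathrm{Op}_{n|1}(D))$.
   Context: $\mathfrak h$ is the diagonal Cartan subalgebra of $\mathfrak{gl}_{n|1}$; $\pi^0_{\mathfrak h}=\mathbb C[\partial^ru_i\mid1\le i\le n+1,\ r\ge0]$ is the commutative vertex algebra (differential algebra) with $u_i$ corresponding to $e_{i,i}$. Its standard Poisson vertex algebra structure is determined by the $\lambda$-bracket $\{u_i{}_\lambda u_j\}=\kappa_V(u_i,u_j)\lambda$, where $\kappa_V(u,v)=\operatorname{str}_{\mathbb C^{n|1}}(uv)$, i.e. $\kappa_V(u_i,u_j)=\delta_{ij}$ for $i\le n$ and $\kappa_V(u_{n+1},u_{n+1})=-1$. $\mathrm{Fun}(\mathrm{Op}_{n|1}(D))$ is the differential subalgebra of $\pi^0_{\mathfrak h}$ generated by the coefficients $W_p$ ($p\ge1$) of $$(\partial-u_1)\cdots(\partial-u_n)(\partial+u_{n+1})^{-1}=\partial^{n-1}+\sum_{p\ge1}W_p\partial^{n-1-p},$$ expanded in formal pseudo-differential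 operators over $\pi^0_{\mathfrak h}$ ($\partial\circ f=f\partial+\partial(f)$). $V^{\kappa_c}(\mathfrak{gl}_{n|1})$ is the universal affine vertex superalgebra at the critical level $\kappa_c=-\frac12\kappa_{\mathfrak g}$ ($\kappa_{\mathfrak g}$ the Killing form), and $\mathfrak z(V)$ denotes the center of a vertex superalgebra $V$ (elements whose fields commute with all fields of $V$). The affine Harish-Chandra map $\widehat\iota_{\mathrm{HC}}$ is the isomorphism of commutative vertex algebras obtained by restricting to the center the Wakimoto free field realization $V^{\kappa_c}(\mathfrak{gl}_{n|1})\hookrightarrow\mathcal A\otimes\pi^0_{\mathfrak h}$, where $\mathcal A$ is the vertex superalgebra of chiral differential operators on the unipotent supergroup $N_+$ of the standard upper-triangular subalgebra; the center maps into $\pi^0_{\mathfrak h}$ with image exactly $\mathrm{Fun}(\mathrm{Op}_{n|1}(D))$. *)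

theory Defs
  imports Complex_Main "HOL-Library.Poly_Mapping"
begin

section \<open>Differential algebras and Poisson vertex algebras\<close>

text \<open>A commutative vertex algebra is the same thing as a commutative unital algebra with a
  derivation; the product is the \<open>(-1)\<close>-product and the derivation is the translation operator.
  The algebra lives on a carrier inside an ambient abelian group.\<close>

record 'a diffalg =
  carr :: "'a set"
  scl :: "complex \<Rightarrow> 'a \<Rightarrow> 'a"
  mul :: "'a \<Rightarrow> 'a \<Rightarrow> 'a"
  unt :: "'a"
  der :: "'a \<Rightarrow> 'a"

locale differential_algebra =
  fixes A :: "'a::ab_group_add diffalg"
  assumes zero_closed: "0 \<in> carr A"
    and add_closed: "a \<in> carr A \<Longrightarrow> b \<in> carr A \<Longrightarrow> a + b \<in> carr A"
    and scl_closed: "a \<in> carr A \<Longrightarrow> scl A s a \<in> carr A"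
    and mul_closed: "a \<in> carr A \<Longrightarrow> b \<in> carr A \<Longrightarrow> mul A a b \<in> carr A"
    and unt_closed: "unt A \<in> carr A"
    and der_closed: "a \<in> carr A \<Longrightarrow> der A a \<in> carr A"
    and scl_add_right: "a \<in> carr A \<Longrightarrow> b \<in> carr A \<Longrightarrow> scl A s (a + b) = scl A s a + scl A s b"
    and scl_add_left: "a \<in> carr A \<Longrightarrow> scl A (s + t) a = scl A s a + scl A t a"
    and scl_scl: "a \<in> carr A \<Longrightarrow> scl A s (scl A t a) = scl A (s * t) a"
    and scl_one: "a \<in> carr A \<Longrightarrow> scl A 1 a = a"
    and mul_assoc: "a \<in> carr A \<Longrightarrow> b \<in> carr A \<Longrightarrow> c \<in> carr A \<Longrightarrow>
      mul A (mul A a b) c = mul A a (mul A b c)"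
    and mul_comm: "a \<in> carr A \<Longrightarrow> b \<in> carr A \<Longrightarrow> mul A a b = mul A b a"
    and mul_unt: "a \<in> carr A \<Longrightarrow> mul A (unt A) a = a"
    and mul_add: "a \<in> carr A \<Longrightarrow> b \<in> carr A \<Longrightarrow> c \<in> carr A \<Longrightarrow>
      mul A a (b + c) = mul A a b + mul A a c"
    and mul_scl: "a \<in> carr A \<Longrightarrow> b \<in> carr A \<Longrightarrow> mul A a (scl A s b) = scl A s (mul A a b)"
    and der_add: "a \<in> carr A \<Longrightarrow> b \<in> carr A \<Longrightarrow> der A (a + b) = der A a + der A b"
    and der_scl: "a \<in> carr A \<Longrightarrow> der A (scl A s a) = scl A s (der A a)"
    and der_mul: "a \<in> carr A \<Longrightarrow> b \<in> carr A \<Longrightarrow>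
      der A (mul A a b) = mul A (der A a) b + mul A a (der A b)"

definition differential_subalgebra :: "'a::ab_group_add diffalg \<Rightarrow> 'a set \<Rightarrow> bool" where
  "differential_subalgebra A B \<longleftrightarrow>
     B \<subseteq> carr A \<and> 0 \<in> B \<and> unt A \<in> B \<and>
     (\<forall>a\<in>B. \<forall>b\<in>B. a + b \<in> B \<and> mul A a b \<in> B) \<and>
     (\<forall>a\<in>B. der A a \<in> B \<and> (\<forall>c. scl A c a \<in> B))"

definition differential_subalgebra_generated :: "'a::ab_group_add diffalg \<Rightarrow> 'a set \<Rightarrow> 'a set" where
  "differential_subalgebra_generated A S = \<Inter> {B. differential_subalgebra A B \<and> S \<subseteq> B}"

definition diffalg_iso ::
  "('a::ab_group_add \<Rightarrow> 'b::ab_group_add) \<Rightarrow> 'a diffalg \<Rightarrow> 'b diffalg \<Rightarrow> bool" where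
  "diffalg_iso f A B \<longleftrightarrow>
     bij_betw f (carr A) (carr B) \<and> f (unt A) = unt B \<and>
     (\<forall>a\<in>carr A. \<forall>b\<in>carr A. f (a + b) = f a + f b \<and> f (mul A a b) = mul B (f a) (f b)) \<and>
     (\<forall>a\<in>carr A. f (der A a) = der B (f a) \<and> (\<forall>c. f (scl A c a) = scl B c (f a)))"

text \<open>\<open>lb a b k\<close> is the coefficient of \<open>\<lambda>^k\<close> in \<open>{a \<lambda> b}\<close> (so the \<open>k\<close>-th product is
  \<open>k!\<close> times it). The axioms are the coefficientwise form of:
  sesquilinearity \<open>{\<partial>a \<lambda> b} = -\<lambda> {a \<lambda> b}\<close>, \<open>{a \<lambda> \<partial>b} = (\<lambda> + \<partial>) {a \<lambda> b}\<close>;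
  skew-symmetry \<open>{b \<lambda> a} = -{a (-\<lambda>-\<partial>) b}\<close> with \<open>\<partial>\<close> acting on the coefficients;
  the Jacobi identity \<open>{a \<lambda> {b \<mu> c}} - {b \<mu> {a \<lambda> c}} = {{a \<lambda> b} (\<lambda>+\<mu>) c}\<close> (coefficient of
  \<open>\<lambda>^k \<mu>^l\<close>); and the left Leibniz rule.\<close>

locale poisson_vertex_algebra = differential_algebra A
  for A :: "'a::ab_group_add diffalg" +
  fixes lb :: "'a \<Rightarrow> 'a \<Rightarrow> nat \<Rightarrow> 'a"
  assumes lb_closed: "a \<in> carr A \<Longrightarrow> b \<in> carr A \<Longrightarrow> lb a b k \<in> carr A"
    and lb_finite: "a \<in> carr A \<Longrightarrow> b \<in> carr A \<Longrightarrow> finite {k. lb a b k \<noteq> 0}"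
    and lb_add_left: "a \<in> carr A \<Longrightarrow> a' \<in> carr A \<Longrightarrow> b \<in> carr A \<Longrightarrow>
      lb (a + a') b k = lb a b k + lb a' b k"
    and lb_add_right: "a \<in> carr A \<Longrightarrow> b \<in> carr A \<Longrightarrow> b' \<in> carr A \<Longrightarrow>
      lb a (b + b') k = lb a b k + lb a b' k"
    and lb_scl_left: "a \<in> carr A \<Longrightarrow> b \<in> carr A \<Longrightarrow> lb (scl A s a) b k = scl A s (lb a b k)"
    and lb_scl_right: "a \<in> carr A \<Longrightarrow> b \<in> carr A \<Longrightarrow> lb a (scl A s b) k = scl A s (lb a b k)"
    and lb_der_left: "a \<in> carr A \<Longrightarrow> b \<in> carr A \<Longrightarrow>
      lb (der A a) b k = (case k of 0 \<Rightarrow> 0 | Suc l \<Rightarrow> - lb a b l)"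
    and lb_der_right: "a \<in> carr A \<Longrightarrow> b \<in> carr A \<Longrightarrow>
      lb a (der A b) k = der A (lb a b k) + (case k of 0 \<Rightarrow> 0 | Suc l \<Rightarrow> lb a b l)"
    and lb_skew: "a \<in> carr A \<Longrightarrow> b \<in> carr A \<Longrightarrow>
      lb b a k = - (\<Sum>l | k \<le> l \<and> lb a b l \<noteq> 0.
        scl A ((-1) ^ l * of_nat (l choose k)) ((der A ^^ (l - k)) (lb a b l)))"
    and lb_jacobi: "a \<in> carr A \<Longrightarrow> b \<in> carr A \<Longrightarrow> c \<in> carr A \<Longrightarrow>
      lb a (lb b c l) k - lb b (lb a c k) l =
        (\<Sum>i\<le>k. scl A (of_nat ((k + l - i) choose l)) (lb (lb a b i) c (k + l - i)))"
    and lb_leibniz: "a \<in> carr A \<Longrightarrow> b \<in> carr A \<Longrightarrow> c \<in> carr A \<Longrightarrow>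
      lb a (mul A b c) k = mul A (lb a b k) c + mul A b (lb a c k)"

definition poisson_vertex_subalgebra ::
  "'a::ab_group_add diffalg \<Rightarrow> ('a \<Rightarrow> 'a \<Rightarrow> nat \<Rightarrow> 'a) \<Rightarrow> 'a set \<Rightarrow> bool" where
  "poisson_vertex_subalgebra A lb B \<longleftrightarrow>
     poisson_vertex_algebra A lb \<and> differential_subalgebra A B \<and>
     (\<forall>a\<in>B. \<forall>b\<in>B. \<forall>k. lb a b k \<in> B)"

definition pva_iso ::
  "('a::ab_group_add \<Rightarrow> 'b::ab_group_add) \<Rightarrow> 'a diffalg \<Rightarrow> ('a \<Rightarrow> 'a \<Rightarrow> nat \<Rightarrow> 'a) \<Rightarrow>
   'b diffalg \<Rightarrow> ('b \<Rightarrow> 'b \<Rightarrow> nat \<Rightarrow> 'b) \<Rightarrow> bool" where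
  "pva_iso f A lbA B lbB \<longleftrightarrow>
     diffalg_iso f A B \<and>
     (\<forall>a\<in>carr A. \<forall>b\<in>carr A. \<forall>k. f (lbA a b k) = lbB (f a) (f b) k)"

definition pullback_bracket ::
  "('a \<Rightarrow> 'b) \<Rightarrow> 'a set \<Rightarrow> ('b \<Rightarrow> 'b \<Rightarrow> nat \<Rightarrow> 'b) \<Rightarrow> 'a \<Rightarrow> 'a \<Rightarrow> nat \<Rightarrow> 'a" where
  "pullback_bracket f C lb a b k = the_inv_into C f (lb (f a) (f b) k)"


section \<open>The differential algebra of the Cartan subalgebra\<close>

text \<open>The variable \<open>(i, r)\<close> stands for \<open>\<partial>^r u_i\<close>; a monomial is a finitely supported exponent
  function and a polynomial a finitely supported function on monomials. Only variables with
  \<open>1 \<le> i \<le> n + 1\<close> occur in the carrier.\<close>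

type_synonym dpoly = "((nat \<times> nat) \<Rightarrow>\<^sub>0 nat) \<Rightarrow>\<^sub>0 complex"

definition lin_scale :: "complex \<Rightarrow> ('x \<Rightarrow>\<^sub>0 complex) \<Rightarrow> ('x \<Rightarrow>\<^sub>0 complex)" where
  "lin_scale c f = Poly_Mapping.map ((*) c) f"

definition uvar :: "nat \<Rightarrow> nat \<Rightarrow> dpoly" where
  "uvar i r = Poly_Mapping.single (Poly_Mapping.single (i, r) 1) 1"

definition dpoly_der :: "dpoly \<Rightarrow> dpoly" where
  "dpoly_der f = (\<Sum>m\<in>Poly_Mapping.keys f. \<Sum>(i, r)\<in>Poly_Mapping.keys m.
     Poly_Mapping.single
       (m - Poly_Mapping.single (i, r) 1 + Poly_Mapping.single (i, Suc r) 1)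
       (of_nat (Poly_Mapping.lookup m (i, r)) * Poly_Mapping.lookup f m))"

definition pi0 :: "nat \<Rightarrow> dpoly diffalg" where
  "pi0 n = \<lparr>carr = {f. \<forall>m\<in>Poly_Mapping.keys f. \<forall>(i, r)\<in>Poly_Mapping.keys m. 1 \<le> i \<and> i \<le> n + 1},
            scl = lin_scale, mul = (*), unt = 1, der = dpoly_der\<rparr>"

text \<open>The parity of the basis vector \<open>e_i\<close> of \<open>\<complex>^{n|1}\<close>; \<open>True\<close> means odd.\<close>

definition odd_index :: "nat \<Rightarrow> nat \<Rightarrow> bool" where
  "odd_index n i \<longleftrightarrow> i = n + 1"

definition psign :: "bool \<Rightarrow> complex" where
  "psign p = (if p then -1 else 1)"

definition kappa_V :: "nat \<Rightarrow> nat \<Rightarrow> nat \<Rightarrow> complex" where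
  "kappa_V n i j = (if i = j then psign (odd_index n i) else 0)"

definition standard_pva :: "nat \<Rightarrow> (dpoly \<Rightarrow> dpoly \<Rightarrow> nat \<Rightarrow> dpoly) \<Rightarrow> bool" where
  "standard_pva n lb \<longleftrightarrow>
     poisson_vertex_algebra (pi0 n) lb \<and>
     (\<forall>i\<in>{1..n+1}. \<forall>j\<in>{1..n+1}. \<forall>k.
        lb (uvar i 0) (uvar j 0) k = (if k = 1 then lin_scale (kappa_V n i j) 1 else 0))"


section \<open>Pseudo-differential operators and functions on opers\<close>

text \<open>\<open>A m\<close> is the coefficient of \<open>\<partial>^m\<close>, written to the left of \<open>\<partial>^m\<close>. The product is
  \<open>(a \<partial>^k) (b \<partial>^l) = \<Sum>j. (k gchoose j) a (\<partial>^j b) \<partial>^(k+l-j)\<close>; since orders are bounded above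
  the index set in \<open>psmul\<close> is finite.\<close>

type_synonym psdo = "int \<Rightarrow> dpoly"

definition psdos :: "nat \<Rightarrow> psdo set" where
  "psdos n = {A. (\<forall>m. A m \<in> carr (pi0 n)) \<and> (\<exists>N. \<forall>m>N. A m = 0)}"

definition psmul :: "psdo \<Rightarrow> psdo \<Rightarrow> psdo" where
  "psmul A B m = (\<Sum>(k, j) | A k \<noteq> 0 \<and> B (m - k + int j) \<noteq> 0.
     lin_scale (of_int k gchoose j) (A k * (dpoly_der ^^ j) (B (m - k + int j))))"

definition psone :: psdo where
  "psone m = (if m = 0 then 1 else 0)"

definition first_order :: "dpoly \<Rightarrow> psdo" where
  "first_order f m = (if m = 1 then 1 else if m = 0 then f else 0)"

definition psinv :: "nat \<Rightarrow> psdo \<Rightarrow> psdo" where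
  "psinv n A = (THE B. B \<in> psdos n \<and> psmul A B = psone \<and> psmul B A = psone)"

definition oper_L :: "nat \<Rightarrow> psdo" where
  "oper_L n = foldr psmul (map (\<lambda>i. first_order (- uvar i 0)) [1..<n+1])
     (psinv n (first_order (uvar (n + 1) 0)))"

definition W_coeff :: "nat \<Rightarrow> nat \<Rightarrow> dpoly" where
  "W_coeff n p = oper_L n (int n - 1 - int p)"

definition FunOp :: "nat \<Rightarrow> dpoly set" where
  "FunOp n = differential_subalgebra_generated (pi0 n) {W_coeff n p | p. p \<ge> 1}"

definition FunOp_alg :: "nat \<Rightarrow> dpoly diffalg" where
  "FunOp_alg n = (pi0 n)\<lparr>carr := FunOp n\<rparr>"


section \<open>Vertex superalgebras\<close>

text \<open>\<open>prd V a m b\<close> is \<open>a_(m) b\<close>, where \<open>Y(a,z) = \<Sum>m. a_(m) z^(-m-1)\<close>; the translation operator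
  is \<open>a \<mapsto> a_(-2) vac\<close>. \<open>part V False\<close> and \<open>part V True\<close> are the even and odd components.\<close>

record 'v vsa =
  vscl :: "complex \<Rightarrow> 'v \<Rightarrow> 'v"
  part :: "bool \<Rightarrow> 'v set"
  vac :: "'v"
  prd :: "'v \<Rightarrow> int \<Rightarrow> 'v \<Rightarrow> 'v"

definition translation :: "('v, 'z) vsa_scheme \<Rightarrow> 'v \<Rightarrow> 'v" where
  "translation V a = prd V a (-2) (vac V)"

text \<open>The \<open>locality\<close> axiom states \<open>(z-w)^N [Y(a,z), Y(b,w)] c = 0\<close> coefficientwise, with \<open>N\<close>
  independent of \<open>c\<close>.\<close>

locale vertex_superalgebra =
  fixes V :: "'v::ab_group_add vsa"
  assumes vs: "vector_space (vscl V)"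
    and part_subspace: "module.subspace (vscl V) (part V p)"
    and part_decomp: "\<exists>a0\<in>part V False. \<exists>a1\<in>part V True. a = a0 + a1"
    and part_disjoint: "part V False \<inter> part V True = {0}"
    and vac_even: "vac V \<in> part V False"
    and prd_part: "a \<in> part V p \<Longrightarrow> b \<in> part V q \<Longrightarrow> prd V a m b \<in> part V (p \<noteq> q)"
    and prd_add_left: "prd V (a + a') m b = prd V a m b + prd V a' m b"
    and prd_add_right: "prd V a m (b + b') = prd V a m b + prd V a m b'"
    and prd_scl_left: "prd V (vscl V z a) m b = vscl V z (prd V a m b)"
    and prd_scl_right: "prd V a m (vscl V z b) = vscl V z (prd V a m b)"
    and truncation: "\<exists>N. \<forall>m\<ge>N. prd V a m b = 0"
    and vac_left: "prd V (vac V) m a = (if m = -1 then a else 0)"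
    and vac_right: "prd V a (-1) (vac V) = a"
    and vac_right_nonneg: "m \<ge> 0 \<Longrightarrow> prd V a m (vac V) = 0"
    and translation_covariance:
      "translation V (prd V a m b) - prd V a m (translation V b) =
         vscl V (- of_int m) (prd V a (m - 1) b)"
    and locality: "a \<in> part V p \<Longrightarrow> b \<in> part V q \<Longrightarrow>
      \<exists>N. \<forall>c m k. (\<Sum>i\<le>N. vscl V ((-1) ^ i * of_nat (N choose i))
          (prd V a (m + int N - int i) (prd V b (k + int i) c)
           - vscl V (psign (p \<and> q)) (prd V b (k + int i) (prd V a (m + int N - int i) c)))) = 0"

definition vsa_hom ::
  "('v::ab_group_add \<Rightarrow> 'w::ab_group_add) \<Rightarrow> 'v vsa \<Rightarrow> 'w vsa \<Rightarrow> bool" where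
  "vsa_hom f V W \<longleftrightarrow>
     (\<forall>a b. f (a + b) = f a + f b) \<and> (\<forall>c a. f (vscl V c a) = vscl W c (f a)) \<and>
     (\<forall>p. f ` part V p \<subseteq> part W p) \<and> f (vac V) = vac W \<and>
     (\<forall>a m b. f (prd V a m b) = prd W (f a) m (f b))"

definition fields_supercommute :: "'v::ab_group_add vsa \<Rightarrow> bool \<Rightarrow> 'v \<Rightarrow> bool \<Rightarrow> 'v \<Rightarrow> bool" where
  "fields_supercommute V p a q b \<longleftrightarrow>
     (\<forall>m k c. prd V a m (prd V b k c) = vscl V (psign (p \<and> q)) (prd V b k (prd V a m c)))"

definition vcenter :: "'v::ab_group_add vsa \<Rightarrow> 'v set" where
  "vcenter V = {a0 + a1 | a0 a1. a0 \<in> part V False \<and> a1 \<in> part V True \<and>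
     (\<forall>q. \<forall>b\<in>part V q. fields_supercommute V False a0 q b \<and> fields_supercommute V True a1 q b)}"

definition center_alg :: "'v::ab_group_add vsa \<Rightarrow> 'v diffalg" where
  "center_alg V = \<lparr>carr = vcenter V, scl = vscl V, mul = (\<lambda>a b. prd V a (-1) b),
                   unt = vac V, der = translation V\<rparr>"


section \<open>Vacuum modules of mode algebras\<close>

text \<open>Consider the associative superalgebra generated by modes \<open>x_m\<close>, \<open>x \<in> I\<close>, \<open>m \<in> \<int>\<close>, with
  \<open>[x_m, y_k] = \<Sum>z\<in>I. sc x y z z_(m+k) + ct x y m k\<close>, and its vacuum module, the quotient by the left
  ideal generated by the \<open>x_m\<close> with \<open>m \<ge> 0\<close>. It is presented as the free associative algebra on the
  modes (linear combinations of words) modulo the span of \<open>vacuum_relators\<close>. The predicate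
  \<open>is_vacuum_vsa\<close> says that \<open>V\<close> is a vertex superalgebra which is this vacuum module, the mode \<open>x_m\<close>
  acting as \<open>(J x)_(m)\<close>; such a structure is unique up to unique isomorphism.\<close>

type_synonym 'i mode_word = "('i \<times> int) list"

definition words_on :: "'i set \<Rightarrow> 'i mode_word set" where
  "words_on I = lists (I \<times> UNIV)"

definition vacuum_relators ::
  "'i set \<Rightarrow> ('i \<Rightarrow> bool) \<Rightarrow> ('i \<Rightarrow> 'i \<Rightarrow> 'i \<Rightarrow> complex) \<Rightarrow> ('i \<Rightarrow> 'i \<Rightarrow> int \<Rightarrow> int \<Rightarrow> complex) \<Rightarrow>
   ('i mode_word \<Rightarrow>\<^sub>0 complex) set" where
  "vacuum_relators I par sc ct =
     {Poly_Mapping.single (u @ [(x, m), (y, k)] @ w) 1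
      - Poly_Mapping.single (u @ [(y, k), (x, m)] @ w) (psign (par x \<and> par y))
      - (\<Sum>z\<in>I. Poly_Mapping.single (u @ [(z, m + k)] @ w) (sc x y z))
      - Poly_Mapping.single (u @ w) (ct x y m k)
      | u w x y m k. u \<in> words_on I \<and> w \<in> words_on I \<and> x \<in> I \<and> y \<in> I}
     \<union> {Poly_Mapping.single (u @ [(x, m)]) 1 | u x m. u \<in> words_on I \<and> x \<in> I \<and> m \<ge> 0}"

definition word_state :: "'v vsa \<Rightarrow> ('i \<Rightarrow> 'v) \<Rightarrow> 'i mode_word \<Rightarrow> 'v" where
  "word_state V J w = foldr (\<lambda>(x, m). prd V (J x) m) w (vac V)"

definition eval_words ::
  "'v::ab_group_add vsa \<Rightarrow> ('i \<Rightarrow> 'v) \<Rightarrow> ('i mode_word \<Rightarrow>\<^sub>0 complex) \<Rightarrow> 'v" where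
  "eval_words V J f = (\<Sum>w\<in>Poly_Mapping.keys f. vscl V (Poly_Mapping.lookup f w) (word_state V J w))"

definition is_vacuum_vsa ::
  "'i set \<Rightarrow> ('i \<Rightarrow> bool) \<Rightarrow> ('i \<Rightarrow> 'i \<Rightarrow> 'i \<Rightarrow> complex) \<Rightarrow> ('i \<Rightarrow> 'i \<Rightarrow> int \<Rightarrow> int \<Rightarrow> complex) \<Rightarrow>
   'v::ab_group_add vsa \<Rightarrow> ('i \<Rightarrow> 'v) \<Rightarrow> bool" where
  "is_vacuum_vsa I par sc ct V J \<longleftrightarrow>
     vertex_superalgebra V \<and> (\<forall>x\<in>I. J x \<in> part V (par x)) \<and>
     (\<forall>f. Poly_Mapping.keys f \<subseteq> words_on I \<longrightarrow>
        (eval_words V J f = 0 \<longleftrightarrow> f \<in> module.span lin_scale (vacuum_relators I par sc ct))) \<and>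
     (\<forall>v. \<exists>f. Poly_Mapping.keys f \<subseteq> words_on I \<and> eval_words V J f = v)"


section \<open>The universal affine vertex superalgebra at the critical level\<close>

text \<open>The pair \<open>(i, j)\<close> stands for the matrix unit \<open>e_{i,j}\<close>.\<close>

definition gl_index :: "nat \<Rightarrow> (nat \<times> nat) set" where
  "gl_index n = {1..n+1} \<times> {1..n+1}"

definition gl_odd :: "nat \<Rightarrow> nat \<times> nat \<Rightarrow> bool" where
  "gl_odd n x \<longleftrightarrow> (odd_index n (fst x) \<noteq> odd_index n (snd x))"

text \<open>\<open>gl_sc n x y z\<close> is the coefficient of \<open>z\<close> in the supercommutator \<open>[x, y]\<close>.\<close>

definition gl_sc :: "nat \<Rightarrow> nat \<times> nat \<Rightarrow> nat \<times> nat \<Rightarrow> nat \<times> nat \<Rightarrow> complex" where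
  "gl_sc n x y z =
     (if snd x = fst y \<and> z = (fst x, snd y) then 1 else 0)
     - psign (gl_odd n x \<and> gl_odd n y) * (if snd y = fst x \<and> z = (fst y, snd x) then 1 else 0)"

text \<open>The Killing form \<open>str (ad x \<circ> ad y)\<close>.\<close>

definition gl_killing :: "nat \<Rightarrow> nat \<times> nat \<Rightarrow> nat \<times> nat \<Rightarrow> complex" where
  "gl_killing n x y =
     (\<Sum>z\<in>gl_index n. psign (gl_odd n z) * (\<Sum>t\<in>gl_index n. gl_sc n y z t * gl_sc n x t z))"

definition kappa_c :: "nat \<Rightarrow> nat \<times> nat \<Rightarrow> nat \<times> nat \<Rightarrow> complex" where
  "kappa_c n x y = - (1/2) * gl_killing n x y"

definition universal_affine_gl ::
  "nat \<Rightarrow> (nat \<times> nat \<Rightarrow> nat \<times> nat \<Rightarrow> complex) \<Rightarrow> 'v::ab_group_add vsa \<Rightarrow> (nat \<times> nat \<Rightarrow> 'v) \<Rightarrow> bool"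
  where
  "universal_affine_gl n kap V J \<longleftrightarrow>
     is_vacuum_vsa (gl_index n) (gl_odd n) (gl_sc n)
       (\<lambda>x y m k. if m + k = 0 then of_int m * kap x y else 0) V J"


section \<open>The Wakimoto realization\<close>

text \<open>\<open>N_+\<close> is the supergroup of upper unitriangular supermatrices with coordinate functions the
  matrix entries above the diagonal. \<open>Crd i j\<close> is the field of the \<open>(i,j)\<close> entry (\<open>a*\<close>) and
  \<open>Vec i j\<close> that of the corresponding coordinate vector field (\<open>a\<close>), with
  \<open>a(z) a*(w) \<sim> 1/(z-w)\<close>; \<open>Crt i\<close> is \<open>u_i\<close>, which has trivial brackets. These generate
  the tensor product of the chiral differential operators on \<open>N_+\<close> with \<open>pi0\<close>.\<close>

datatype ffgen = Crd nat nat | Vec nat nat | Crt nat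

definition ff_index :: "nat \<Rightarrow> ffgen set" where
  "ff_index n = {Crd i j | i j. 1 \<le> i \<and> i < j \<and> j \<le> n + 1}
     \<union> {Vec i j | i j. 1 \<le> i \<and> i < j \<and> j \<le> n + 1} \<union> {Crt i | i. 1 \<le> i \<and> i \<le> n + 1}"

fun ff_odd :: "nat \<Rightarrow> ffgen \<Rightarrow> bool" where
  "ff_odd n (Crd i j) = gl_odd n (i, j)"
| "ff_odd n (Vec i j) = gl_odd n (i, j)"
| "ff_odd n (Crt i) = False"

fun ff_ct :: "nat \<Rightarrow> ffgen \<Rightarrow> ffgen \<Rightarrow> int \<Rightarrow> int \<Rightarrow> complex" where
  "ff_ct n (Vec i j) (Crd k l) m r = (if (i, j) = (k, l) \<and> m + r = -1 then 1 else 0)"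
| "ff_ct n (Crd i j) (Vec k l) m r =
     (if (i, j) = (k, l) \<and> m + r = -1 then - psign (gl_odd n (i, j)) else 0)"
| "ff_ct n _ _ m r = 0"

definition free_field_vsa :: "nat \<Rightarrow> 'w::ab_group_add vsa \<Rightarrow> (ffgen \<Rightarrow> 'w) \<Rightarrow> bool" where
  "free_field_vsa n W G \<longleftrightarrow>
     is_vacuum_vsa (ff_index n) (ff_odd n) (\<lambda>x y z. 0) (ff_ct n) W G"

definition pi0_embedding ::
  "nat \<Rightarrow> 'w::ab_group_add vsa \<Rightarrow> (ffgen \<Rightarrow> 'w) \<Rightarrow> (dpoly \<Rightarrow> 'w) \<Rightarrow> bool" where
  "pi0_embedding n W G j \<longleftrightarrow>
     inj_on j (carr (pi0 n)) \<and> j 1 = vac W \<and>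
     (\<forall>f\<in>carr (pi0 n). \<forall>g\<in>carr (pi0 n). j (f + g) = j f + j g \<and> j (f * g) = prd W (j f) (-1) (j g)) \<and>
     (\<forall>f\<in>carr (pi0 n). j (dpoly_der f) = translation W (j f) \<and>
        (\<forall>c. j (lin_scale c f) = vscl W c (j f))) \<and>
     (\<forall>i\<in>{1..n+1}. j (uvar i 0) = G (Crt i))"

text \<open>\<open>\<g>\<close> acts by infinitesimal right translations on the big cell
  \<open>N_+ \<subseteq> B_- \ G\<close>, twisted by a character of \<open>B_-\<close>; the images of \<open>e_{k,k}\<close>, \<open>e_{k,k+1}\<close> and
  \<open>e_{k+1,k}\<close> below are the normally ordered versions of the resulting first order operators, with
  the quantum correction \<open>(k - n) \<partial>a*\<close>, which vanishes for the odd simple root \<open>k = n\<close>. These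
  elements generate \<open>\<g>\<close>, so they determine the homomorphism.\<close>

definition wakimoto ::
  "nat \<Rightarrow> 'v::ab_group_add vsa \<Rightarrow> (nat \<times> nat \<Rightarrow> 'v) \<Rightarrow> 'w::ab_group_add vsa \<Rightarrow> (ffgen \<Rightarrow> 'w) \<Rightarrow>
   ('v \<Rightarrow> 'w) \<Rightarrow> bool" where
  "wakimoto n V J W G w \<longleftrightarrow>
     (let no = (\<lambda>a b. prd W a (-1) b); x = (\<lambda>i j. G (Crd i j)); d = (\<lambda>i j. G (Vec i j));
          u = (\<lambda>i. G (Crt i))
      in vsa_hom w V W \<and> inj w \<and>
         (\<forall>k\<in>{1..n+1}. w (J (k, k)) =
            (\<Sum>i\<in>{1..<k}. no (x i k) (d i k)) - (\<Sum>j\<in>{k+1..n+1}. no (x k j) (d k j)) + u k) \<and>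
         (\<forall>k\<in>{1..n}. w (J (k, k+1)) = d k (k+1) + (\<Sum>i\<in>{1..<k}. no (x i k) (d i (k+1)))) \<and>
         (\<forall>k\<in>{1..<n}. w (J (k+1, k)) =
            (\<Sum>i\<in>{1..<k}. no (x i (k+1)) (d i k))
            - (\<Sum>j\<in>{k+2..n+1}. no (x k j) (d (k+1) j))
            - (\<Sum>j\<in>{k+1..n+1}. no (x k (k+1)) (no (x k j) (d k j)))
            + (\<Sum>j\<in>{k+2..n+1}. no (x k (k+1)) (no (x (k+1) j) (d (k+1) j)))
            + no (x k (k+1)) (u k) - no (x k (k+1)) (u (k+1))
            + vscl W (of_nat k - of_nat n) (translation W (x k (k+1)))) \<and>
         w (J (n+1, n)) =
            (\<Sum>i\<in>{1..<n}. no (x i (n+1)) (d i n)) + no (x n (n+1)) (u n) + no (x n (n+1)) (u (n+1)))"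

text \<open>The Wakimoto map followed by the inverse of the inclusion of \<open>pi0\<close>.\<close>

definition affine_HC :: "nat \<Rightarrow> (dpoly \<Rightarrow> 'w) \<Rightarrow> ('v \<Rightarrow> 'w) \<Rightarrow> 'v \<Rightarrow> dpoly" where
  "affine_HC n j w z = the_inv_into (carr (pi0 n)) j (w z)"

end

theory Submission
  imports Defs "HOL-Library.Infinite_Set" "HOL-Computational_Algebra.Formal_Power_Series"
begin

text \<open>Write \<open>L = (\<partial> - u\<^sub>1) \<cdots> (\<partial> - u\<^sub>n) (\<partial> + u\<^sub>n\<^sub>+\<^sub>1)\<^sup>-\<^sup>1\<close>. The point is that the brackets of the
  coefficients of \<open>L\<close> with one another are given by the second Gelfand--Dickey (Adler) formula, whose
  right-hand side involves the coefficients of \<open>L\<close> and their derivatives only.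

  To state it without formal distributions, adjoin a free differential variable \<open>f\<close>, the test
  function, and replace the polynomial \<open>{a \<lambda> b} = \<Sum>k. c\<^sub>k \<lambda>^k\<close> by the differential form
  \<open>\<Sum>k. c\<^sub>k \<partial>^k f\<close>. Sesquilinearity and the Leibniz rule say that \<open>b \<mapsto> \<Sum>k. c\<^sub>k \<partial>^k f\<close> is a derivation
  that commutes with \<open>\<partial>\<close>; applied to coefficients it is therefore a derivation of the ring of
  pseudo-differential operators (\<open>derivation_on.ext_pmul\<close>). Let \<open>\<delta>\<close> be the one given by
  \<open>a = L\<^sub>m\<close>, the coefficient of \<open>\<partial>^m\<close> in \<open>L\<close>, and let \<open>F = \<partial>^(-m-1) f\<close>. The formula reads
  \<open>\<delta> L = L (F L)\<^sub>+ - (L F)\<^sub>+ L\<close>, where \<open>+\<close> drops the negative powers of \<open>\<partial>\<close>.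

  It is multiplicative: if \<open>L = X P P' Y\<close>, the analogous formulas for \<open>\<delta> P\<close> and \<open>\<delta> P'\<close> add up to the one
  for \<open>\<delta> (P P')\<close> because the two middle terms cancel (\<open>derivation.adler_pmul\<close>). So only the
  single factors have to be checked. For \<open>\<partial> - u\<^sub>i\<close> the formula says that \<open>\<delta> u\<^sub>i = - \<partial> Res (Y F X)\<close>;
  for \<open>(\<partial> + u\<^sub>n\<^sub>+\<^sub>1)\<^sup>-\<^sup>1\<close> the passage to the inverse reverses a sign, which is compensated by the
  sign of \<open>\<kappa>\<close> at the odd index. Both values of \<open>\<delta>\<close> follow by skew-symmetry from \<open>{u\<^sub>i \<lambda> L}\<close>, which is
  immediate, since \<open>u\<^sub>i\<close> has a nonzero bracket with one factor only: skew-symmetry is passage to the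
  formal adjoint, and the formal adjoint turns \<open>Res (X f Z)\<close> into \<open>Res (Z f X)\<close>
  (\<open>test_function.Ad_residue\<close>).

  Reading off the coefficients of \<open>\<partial>^k f\<close> gives the brackets of generators
  (\<open>oper_bracket.lb_oper_closed\<close>), and a differential subalgebra that contains the brackets of its
  generators is closed under the bracket. The second claim is transport of structure along the
  Harish-Chandra map, which is an isomorphism onto the functions on opers because the Wakimoto map and
  the inclusion of the Cartan part are injective homomorphisms that map the center and the functions
  on opers, respectively, onto the same set.\<close>

section \<open>Integer binomial coefficients\<close>

text \<open>The integral version makes the coefficients act on every commutative ring.\<close>

definition ibinom :: "int \<Rightarrow> nat \<Rightarrow> int" where
  "ibinom a k = \<lfloor>(of_int a :: rat) gchoose k\<rfloor>"

lemma of_int_ibinom: "of_int (ibinom a k) = (of_int a :: 'b::field_char_0) gchoose k"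
  by (simp add: ibinom_def of_int_gbinomial[symmetric])

lemma ibinom_eqI: "(of_int a :: rat) gchoose k = of_int b \<Longrightarrow> ibinom a k = b"
  by (simp add: ibinom_def)

lemma ibinom_0_right [simp]: "ibinom a 0 = 1"
  by (rule ibinom_eqI) simp

lemma ibinom_of_nat: "ibinom (int n) k = int (n choose k)"
  by (rule ibinom_eqI) (simp add: binomial_gbinomial)

lemma ibinom_0_left: "ibinom 0 k = (if k = 0 then 1 else 0)"
  using ibinom_of_nat[of 0 k] by auto

lemma ibinom_1_left: "ibinom 1 k = (if k \<le> 1 then 1 else 0)"
  using ibinom_of_nat[of 1 k] by (cases k) auto

lemma ibinom_negated_upper: "ibinom a k = (-1) ^ k * ibinom (int k - a - 1) k"
  by (rule ibinom_eqI) (simp add: of_int_ibinom gbinomial_negated_upper[of "of_int a"])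

lemma ibinom_Vandermonde:
  "(\<Sum>s\<le>b. ibinom x s * ibinom y (b - s)) = ibinom (x + y) b"
  by (rule sym, rule ibinom_eqI)
    (simp add: of_int_ibinom gbinomial_Vandermonde[symmetric] atMost_atLeast0)

lemma ibinom_trinomial_revision:
  "ibinom x (a + s) * int ((a + s) choose s) = ibinom x a * ibinom (x - int a) s"
proof -
  have "(of_int (ibinom x (a + s) * int ((a + s) choose s)) :: rat)
      = of_int (ibinom x a * ibinom (x - int a) s)"
    using gbinomial_trinomial_revision[of a "a + s" "of_int x :: rat"]
      binomial_symmetric[of a "a + s"]
    by (simp add: of_int_ibinom binomial_gbinomial[symmetric] del: of_nat_add)
  thus ?thesis by (simp only: of_int_eq_iff)
qed

text \<open>This identity is the associativity of the product of pseudo-differential operators: the two sides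
  are the coefficients of \<open>D^a g * D^b h\<close> obtained by expanding \<open>(\<partial>^p g \<partial>^q) h\<close> and
  \<open>\<partial>^p (g \<partial>^q h)\<close> respectively.\<close>

lemma ibinom_compose_sum:
  "ibinom p a * ibinom (p + q - int a) b
   = (\<Sum>s\<le>b. ibinom p (a + s) * ibinom q (b - s) * int ((a + s) choose s))"
proof -
  have "(\<Sum>s\<le>b. ibinom p (a + s) * ibinom q (b - s) * int ((a + s) choose s))
      = (\<Sum>s\<le>b. ibinom p a * (ibinom (p - int a) s * ibinom q (b - s)))"
    by (intro sum.cong refl) (metis ibinom_trinomial_revision mult.assoc mult.commute)
  also have "\<dots> = ibinom p a * ibinom (p + q - int a) b"
    by (simp add: sum_distrib_left[symmetric] ibinom_Vandermonde) (simp add: algebra_simps)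
  finally show ?thesis ..
qed

section \<open>Derivations of commutative rings\<close>

locale derivation =
  fixes D :: "'a::comm_ring_1 \<Rightarrow> 'a"
  assumes D_add: "D (x + y) = D x + D y"
    and D_mult: "D (x * y) = D x * y + x * D y"
begin

lemma D_0 [simp]: "D 0 = 0"
  using D_add[of 0 0] by simp

lemma D_1 [simp]: "D 1 = 0"
  using D_mult[of 1 1] by simp

lemma D_minus: "D (- x) = - D x"
  using D_add[of x "- x"] by (simp add: eq_neg_iff_add_eq_0 add.commute)

lemma D_diff: "D (x - y) = D x - D y"
  using D_add[of x "- y"] by (simp add: D_minus)

lemma D_sum: "D (\<Sum>x\<in>S. g x) = (\<Sum>x\<in>S. D (g x))"
  by (induction S rule: infinite_finite_induct) (auto simp: D_add)

lemma D_of_nat [simp]: "D (of_nat c) = 0"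
  by (induction c) (auto simp: D_add)

lemma D_of_int [simp]: "D (of_int c) = 0"
  by (cases c rule: int_diff_cases) (simp add: D_diff)

lemma Dn_0 [simp]: "(D ^^ j) 0 = 0"
  by (induction j) auto

lemma Dn_1: "j > 0 \<Longrightarrow> (D ^^ j) 1 = 0"
  by (cases j) (auto simp: funpow_Suc_right simp del: funpow.simps)

lemma Dn_add: "(D ^^ j) (x + y) = (D ^^ j) x + (D ^^ j) y"
  by (induction j) (auto simp: D_add)

lemma Dn_sum: "(D ^^ j) (\<Sum>x\<in>S. g x) = (\<Sum>x\<in>S. (D ^^ j) (g x))"
  by (induction S rule: infinite_finite_induct) (auto simp: Dn_add)

lemma Dn_of_int_mult: "(D ^^ j) (of_int c * x) = of_int c * (D ^^ j) x"
  by (induction j) (auto simp: D_mult)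

lemma Dn_mult:
  "(D ^^ n) (x * y) = (\<Sum>i\<le>n. of_nat (n choose i) * ((D ^^ (n - i)) x * (D ^^ i) y))"
proof (induction n)
  case (Suc n)
  let ?t = "\<lambda>c i. of_nat c * ((D ^^ (Suc n - i)) x * (D ^^ i) y)"
  have eq: "D (of_nat (n choose i) * ((D ^^ (n - i)) x * (D ^^ i) y))
      = ?t (n choose i) i + ?t (n choose i) (Suc i)" if "i \<le> n" for i
    using that by (simp add: D_mult Suc_diff_le algebra_simps)
  have "(D ^^ Suc n) (x * y) = (\<Sum>i\<le>n. ?t (n choose i) i) + (\<Sum>i\<le>n. ?t (n choose i) (Suc i))"
    using eq by (simp add: Suc D_sum sum.distrib)
  also have "(\<Sum>i\<le>n. ?t (n choose i) i) = (\<Sum>i\<le>Suc n. ?t (n choose i) i)"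
    by (simp add: binomial_eq_0)
  also have "\<dots> + (\<Sum>i\<le>n. ?t (n choose i) (Suc i)) = (\<Sum>i\<le>Suc n. ?t (Suc n choose i) i)"
    by (simp only: sum.atMost_Suc_shift)
      (simp add: sum.distrib[symmetric] algebra_simps del: sum.atMost_Suc)
  finally show ?case .
qed auto

end

section \<open>The ring of formal pseudo-differential operators\<close>

text \<open>An operator is the sequence of its coefficients, written to the left of the powers of \<open>\<partial>\<close>. The
  upper bound on the order is what makes products well defined.\<close>

typedef (overloaded) 'a psd = "{A :: int \<Rightarrow> 'a::zero. \<exists>N. \<forall>m>N. A m = 0}"
  morphisms cf Psd
  by (intro exI[of _ "\<lambda>_. 0"]) auto

setup_lifting type_definition_psd

lemma psd_eqI: "(\<And>m. cf A m = cf B m) \<Longrightarrow> A = B"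
  by (simp add: cf_inject[symmetric] fun_eq_iff)

definition order_le :: "'a::zero psd \<Rightarrow> int \<Rightarrow> bool" where
  "order_le A N \<longleftrightarrow> (\<forall>m>N. cf A m = 0)"

lemma order_leD: "order_le A N \<Longrightarrow> m > N \<Longrightarrow> cf A m = 0"
  by (simp add: order_le_def)

lemma order_le_ex: "\<exists>N. order_le A N"
  using cf[of A] by (auto simp: order_le_def)

lemma order_le_mono: "order_le A N \<Longrightarrow> N \<le> M \<Longrightarrow> order_le A M"
  by (auto simp: order_le_def)

instantiation psd :: (ab_group_add) ab_group_add
begin

lift_definition zero_psd :: "'a psd" is "\<lambda>_. 0" by simp

lift_definition plus_psd :: "'a psd \<Rightarrow> 'a psd \<Rightarrow> 'a psd" is "\<lambda>A B m. A m + B m"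
proof -
  fix A B :: "int \<Rightarrow> 'a"
  assume "\<exists>N. \<forall>m>N. A m = 0" "\<exists>N. \<forall>m>N. B m = 0"
  then obtain N M where "\<forall>m>N. A m = 0" "\<forall>m>M. B m = 0" by blast
  thus "\<exists>N. \<forall>m>N. A m + B m = 0" by (intro exI[of _ "max N M"]) auto
qed

lift_definition minus_psd :: "'a psd \<Rightarrow> 'a psd \<Rightarrow> 'a psd" is "\<lambda>A B m. A m - B m"
proof -
  fix A B :: "int \<Rightarrow> 'a"
  assume "\<exists>N. \<forall>m>N. A m = 0" "\<exists>N. \<forall>m>N. B m = 0"
  then obtain N M where "\<forall>m>N. A m = 0" "\<forall>m>M. B m = 0" by blast
  thus "\<exists>N. \<forall>m>N. A m - B m = 0" by (intro exI[of _ "max N M"]) auto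
qed

lift_definition uminus_psd :: "'a psd \<Rightarrow> 'a psd" is "\<lambda>A m. - A m" by auto

instance
  by standard (transfer; simp add: fun_eq_iff algebra_simps)+

end

lemma cf_0 [simp]: "cf 0 m = 0"
  by transfer simp
lemma cf_add [simp]: "cf (A + B) m = cf A m + cf B m"
  by transfer simp
lemma cf_diff [simp]: "cf (A - B) m = cf A m - cf B m"
  by transfer simp
lemma cf_minus [simp]: "cf (- A) m = - cf A m"
  by transfer simp

lift_definition monomial_op :: "'a::zero \<Rightarrow> int \<Rightarrow> 'a psd" is
  "\<lambda>a k m. if m = k then a else 0"
  by auto

lemma cf_monomial_op: "cf (monomial_op a k) m = (if m = k then a else 0)"
  by transfer simp

context derivation
begin

definition pterm :: "'a psd \<Rightarrow> 'a psd \<Rightarrow> int \<Rightarrow> int \<Rightarrow> nat \<Rightarrow> 'a" where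
  "pterm A B m k j = of_int (ibinom k j) * (cf A k * (D ^^ j) (cf B (m - k + int j)))"

definition pmul :: "'a psd \<Rightarrow> 'a psd \<Rightarrow> 'a psd" where
  "pmul A B = Psd (\<lambda>m. \<Sum>(k, j) | cf A k \<noteq> 0 \<and> cf B (m - k + int j) \<noteq> 0. pterm A B m k j)"

text \<open>The natural set of summands depends on the supports of both factors, so that sums for different
  products cannot be compared. Any sufficiently large box gives the same value, and one box can be
  chosen for several products at once.\<close>

lemma sum_pterm_box:
  assumes "order_le A N" "order_le B M"
    and "finite P" "{m - M..N} \<subseteq> P" "nat (N + M - m) \<le> J"
  shows "(\<Sum>(k, j) | cf A k \<noteq> 0 \<and> cf B (m - k + int j) \<noteq> 0. pterm A B m k j)
       = (\<Sum>k\<in>P. \<Sum>j\<le>J. pterm A B m k j)"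
proof -
  have "(\<Sum>(k, j) | cf A k \<noteq> 0 \<and> cf B (m - k + int j) \<noteq> 0. pterm A B m k j)
      = (\<Sum>(k, j)\<in>P \<times> {..J}. pterm A B m k j)"
  proof (intro sum.mono_neutral_left)
    show "{(k, j). cf A k \<noteq> 0 \<and> cf B (m - k + int j) \<noteq> 0} \<subseteq> P \<times> {..J}"
    proof safe
      fix k j assume "cf A k \<noteq> 0" "cf B (m - k + int j) \<noteq> 0"
      hence k: "k \<le> N" and j: "m - k + int j \<le> M"
        using assms(1,2) by (meson not_le order_leD)+
      hence "m - M \<le> k" by linarith
      thus "k \<in> P" using assms(4) k by auto
      show "j \<le> J" using k j assms(5) by linarith
    qed
  qed (use assms(3) in \<open>auto simp: pterm_def\<close>)
  thus ?thesis by (simp add: sum.cartesian_product)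
qed

lemma cf_pmul_support:
  "cf (pmul A B) m = (\<Sum>(k, j) | cf A k \<noteq> 0 \<and> cf B (m - k + int j) \<noteq> 0. pterm A B m k j)"
proof -
  obtain N M where NM: "order_le A N" "order_le B M"
    using order_le_ex by metis
  have "(\<Sum>(k, j) | cf A k \<noteq> 0 \<and> cf B (m - k + int j) \<noteq> 0. pterm A B m k j) = 0" if "m > N + M" for m
    using that sum_pterm_box[OF NM, of "{m - M..N}" m 0] by auto
  thus ?thesis
    unfolding pmul_def by (subst Psd_inverse) auto
qed

lemma cf_pmul:
  assumes "order_le A N" "order_le B M"
    and "finite P" "{m - M..N} \<subseteq> P" "nat (N + M - m) \<le> J"
  shows "cf (pmul A B) m
       = (\<Sum>k\<in>P. \<Sum>j\<le>J. of_int (ibinom k j) * (cf A k * (D ^^ j) (cf B (m - k + int j))))"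
  using sum_pterm_box[OF assms] by (simp add: cf_pmul_support pterm_def)

lemma cf_pmul_ex:
  obtains P J where "finite P"
    "\<And>P' J'. finite P' \<Longrightarrow> P \<subseteq> P' \<Longrightarrow> J \<le> J' \<Longrightarrow> cf (pmul A B) m
       = (\<Sum>k\<in>P'. \<Sum>j\<le>J'. of_int (ibinom k j) * (cf A k * (D ^^ j) (cf B (m - k + int j))))"
proof -
  obtain N M where NM: "order_le A N" "order_le B M"
    using order_le_ex by metis
  show thesis
    by (rule that[of "{m - M..N}"]) (simp, rule cf_pmul[OF NM], auto)
qed

lemma order_le_pmul:
  assumes "order_le A N" "order_le B M"
  shows "order_le (pmul A B) (N + M)"
  unfolding order_le_def using cf_pmul[OF assms, of "{}"] by auto

lemma cf_pmul_top:
  assumes "order_le A N" "order_le B M"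
  shows "cf (pmul A B) (N + M) = cf A N * cf B M"
  using cf_pmul[OF assms, of "{N}" "N + M" 0] by simp

text \<open>Both sides expand into sums of \<open>\<Phi> p q a b\<close>, the product of \<open>A\<^sub>p\<close>, \<open>D^a B\<^sub>q\<close> and \<open>D^b C\<close>. On
  the left this only needs a shift of the summation variable; on the right it needs the Leibniz rule for
  \<open>D^i (B\<^sub>q D^l C)\<close>. The coefficients agree by \<open>ibinom_compose_sum\<close>.\<close>

lemma pmul_assoc: "pmul (pmul A B) C = pmul A (pmul B C)"
proof (rule psd_eqI)
  fix m
  obtain NA NB NC where NABC: "order_le A NA" "order_le B NB" "order_le C NC"
    using order_le_ex by metis
  \<comment> \<open>One bound for all three orders, at least \<open>\<bar>m\<bar>\<close>, so that a single box serves all sums.\<close>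
  define N where "N = Max {NA, NB, NC, \<bar>m\<bar>}"
  have N0: "\<bar>m\<bar> \<le> N" by (simp add: N_def)
  have oA: "order_le A N" and oB: "order_le B N" and oC: "order_le C N"
    using NABC by (auto simp: N_def intro: order_le_mono)
  define J where "J = nat (3 * N - m)"
  define P where "P = {m - 2 * N..N}"
  define \<Phi> where "\<Phi> p q a b = cf A p * (D ^^ a) (cf B q) * (D ^^ b) (cf C (m - p - q + int a + int b))"
    for p q a b
  have \<Phi>0: "\<Phi> p q a b = 0"
    if "p \<notin> P \<or> q \<notin> P \<or> a + b > J" for p q a b
  proof -
    have "p > N \<or> q > N \<or> m - p - q + int a + int b > N"
      using that N0 by (auto simp: P_def J_def)
    thus ?thesis using oA oB oC by (auto simp: \<Phi>_def order_leD)
  qed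
  have "cf (pmul (pmul A B) C) m = (\<Sum>k\<in>{m - N..2 * N}. \<Sum>b\<le>J.
      of_int (ibinom k b) * (cf (pmul A B) k * (D ^^ b) (cf C (m - k + int b))))"
    using cf_pmul[OF order_le_pmul[OF oA oB] oC, of "{m - N..2 * N}" m J] by (simp add: J_def)
  also have "\<dots> = (\<Sum>k\<in>{m - N..2 * N}. \<Sum>b\<le>J. of_int (ibinom k b) *
      ((\<Sum>p\<in>P. \<Sum>a\<le>J. of_int (ibinom p a) * (cf A p * (D ^^ a) (cf B (k - p + int a))))
        * (D ^^ b) (cf C (m - k + int b))))"
  proof (intro sum.cong refl)
    fix k b assume k: "k \<in> {m - N..2 * N}"
    show "of_int (ibinom k b) * (cf (pmul A B) k * (D ^^ b) (cf C (m - k + int b))) =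
      of_int (ibinom k b) *
      ((\<Sum>p\<in>P. \<Sum>a\<le>J. of_int (ibinom p a) * (cf A p * (D ^^ a) (cf B (k - p + int a))))
        * (D ^^ b) (cf C (m - k + int b)))"
      by (subst cf_pmul[OF oA oB, of P k J]) (use k in \<open>auto simp: P_def J_def\<close>)
  qed
  also have "\<dots> = (\<Sum>k\<in>{m - N..2 * N}. \<Sum>b\<le>J. \<Sum>p\<in>P. \<Sum>a\<le>J.
      of_int (ibinom p a * ibinom k b) * \<Phi> p (k - p + int a) a b)"
    by (simp add: \<Phi>_def sum_distrib_left sum_distrib_right algebra_simps)
  also have "\<dots> = (\<Sum>p\<in>P. \<Sum>a\<le>J. \<Sum>b\<le>J. \<Sum>k\<in>{m - N..2 * N}.
      of_int (ibinom p a * ibinom k b) * \<Phi> p (k - p + int a) a b)"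
  proof -
    have sw: "(\<Sum>k\<in>K. \<Sum>b\<in>S. \<Sum>p\<in>P. \<Sum>a\<in>S. g k b p a) = (\<Sum>p\<in>P. \<Sum>a\<in>S. \<Sum>b\<in>S. \<Sum>k\<in>K. g k b p a)"
      for K :: "int set" and S :: "nat set" and P :: "int set" and g :: "int \<Rightarrow> nat \<Rightarrow> int \<Rightarrow> nat \<Rightarrow> 'a"
    proof -
      have "(\<Sum>k\<in>K. \<Sum>b\<in>S. \<Sum>p\<in>P. \<Sum>a\<in>S. g k b p a) = (\<Sum>b\<in>S. \<Sum>k\<in>K. \<Sum>p\<in>P. \<Sum>a\<in>S. g k b p a)"
        by (rule sum.swap)
      also have "\<dots> = (\<Sum>b\<in>S. \<Sum>p\<in>P. \<Sum>k\<in>K. \<Sum>a\<in>S. g k b p a)"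
        by (intro sum.cong refl sum.swap)
      also have "\<dots> = (\<Sum>p\<in>P. \<Sum>b\<in>S. \<Sum>k\<in>K. \<Sum>a\<in>S. g k b p a)"
        by (rule sum.swap)
      also have "\<dots> = (\<Sum>p\<in>P. \<Sum>b\<in>S. \<Sum>a\<in>S. \<Sum>k\<in>K. g k b p a)"
        by (intro sum.cong refl sum.swap)
      also have "\<dots> = (\<Sum>p\<in>P. \<Sum>a\<in>S. \<Sum>b\<in>S. \<Sum>k\<in>K. g k b p a)"
        by (intro sum.cong refl sum.swap)
      finally show ?thesis .
    qed
    show ?thesis by (rule sw)
  qed
  \<comment> \<open>Substitute \<open>q = k - p + a\<close>; the terms that leave the box vanish.\<close>
  also have "\<dots> = (\<Sum>p\<in>P. \<Sum>a\<le>J. \<Sum>b\<le>J. \<Sum>q\<in>P.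
      of_int (ibinom p a * ibinom (p + q - int a) b) * \<Phi> p q a b)"
  proof ((rule sum.cong[OF refl])+)
    fix p a b assume "p \<in> P" and a: "a \<in> {..J}" and b: "b \<in> {..J}"
    show "(\<Sum>k\<in>{m - N..2 * N}. of_int (ibinom p a * ibinom k b) * \<Phi> p (k - p + int a) a b)
      = (\<Sum>q\<in>P. of_int (ibinom p a * ibinom (p + q - int a) b) * \<Phi> p q a b)"
    proof (rule sum.reindex_bij_witness_not_neutral[where
          S' = "{k \<in> {m - N..2 * N}. k - p + int a \<notin> P}" and
          T' = "{q \<in> P. p + q - int a \<notin> {m - N..2 * N}}" and
          i = "\<lambda>q. p + q - int a" and j = "\<lambda>k. k - p + int a"])
      show "finite {k \<in> {m - N..2 * N}. k - p + int a \<notin> P}"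
        "finite {q \<in> P. p + q - int a \<notin> {m - N..2 * N}}"
        by (simp_all only: P_def finite_atLeastAtMost_int finite_Collect_conjI disjI1 Collect_mem_eq)
      show "of_int (ibinom p a * ibinom (p + q - int a) b) * \<Phi> p q a b = 0"
        if "q \<in> {q \<in> P. p + q - int a \<notin> {m - N..2 * N}}" for q
      proof -
        have "p > N \<or> q > N \<or> m - p - q + int a + int b > N"
          using that by auto
        hence "\<Phi> p q a b = 0"
          using oA oB oC by (auto simp: \<Phi>_def order_leD)
        thus ?thesis by simp
      qed
    qed (auto simp: \<Phi>0 P_def)
  qed
  also have "\<dots> = (\<Sum>p\<in>P. \<Sum>a\<le>J. \<Sum>b\<le>J. \<Sum>q\<in>P. \<Sum>s\<le>b.
      of_int (ibinom p (a + s) * ibinom q (b - s) * int ((a + s) choose s)) * \<Phi> p q a b)"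
    by (simp only: ibinom_compose_sum of_int_sum sum_distrib_right)
  also have "\<dots> = (\<Sum>p\<in>P. \<Sum>q\<in>P. \<Sum>a\<le>J. \<Sum>b\<le>J. \<Sum>s\<le>b.
      of_int (ibinom p (a + s) * ibinom q (b - s) * int ((a + s) choose s)) * \<Phi> p q a b)"
  proof (intro sum.cong refl)
    fix p
    let ?g = "\<lambda>q a b. \<Sum>s\<le>b.
      of_int (ibinom p (a + s) * ibinom q (b - s) * int ((a + s) choose s)) * \<Phi> p q a b"
    have "(\<Sum>a\<le>J. \<Sum>b\<le>J. \<Sum>q\<in>P. ?g q a b) = (\<Sum>a\<le>J. \<Sum>q\<in>P. \<Sum>b\<le>J. ?g q a b)"
      by (intro sum.cong refl sum.swap)
    also have "\<dots> = (\<Sum>q\<in>P. \<Sum>a\<le>J. \<Sum>b\<le>J. ?g q a b)"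
      by (rule sum.swap)
    finally show "(\<Sum>a\<le>J. \<Sum>b\<le>J. \<Sum>q\<in>P. ?g q a b) = \<dots>" .
  qed
  \<comment> \<open>Substitute \<open>i = a + s\<close> and \<open>l = b - s\<close>, where \<open>s\<close> counts the derivatives that the Leibniz rule
    moves from \<open>B\<^sub>q\<close> to \<open>C\<close>.\<close>
  also have "\<dots> = (\<Sum>p\<in>P. \<Sum>q\<in>P. \<Sum>i\<le>J. \<Sum>l\<le>J. \<Sum>s\<le>i.
      of_int (ibinom p i * ibinom q l * int (i choose s)) * \<Phi> p q (i - s) (s + l))"
  proof (rule sum.cong[OF refl], rule sum.cong[OF refl])
    fix p q
    let ?f = "\<lambda>(a, b, s). of_int (ibinom p (a + s) * ibinom q (b - s) * int ((a + s) choose s))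
      * \<Phi> p q a b"
    let ?g = "\<lambda>(i, l, s). of_int (ibinom p i * ibinom q l * int (i choose s))
      * \<Phi> p q (i - s) (s + l)"
    have "(\<Sum>a\<le>J. \<Sum>b\<le>J. \<Sum>s\<le>b.
        of_int (ibinom p (a + s) * ibinom q (b - s) * int ((a + s) choose s)) * \<Phi> p q a b)
      = (\<Sum>x\<in>(SIGMA a:{..J}. SIGMA b:{..J}. {..b}). ?f x)"
      by (simp add: sum.Sigma)
    also have "\<dots> = (\<Sum>x\<in>(SIGMA i:{..J}. SIGMA l:{..J}. {..i}). ?g x)"
    proof (rule sum.reindex_bij_witness_not_neutral[where
          S' = "{(a, b, s). a \<le> J \<and> b \<le> J \<and> s \<le> b \<and> a + b > J}" and
          T' = "{(i, l, s). i \<le> J \<and> l \<le> J \<and> s \<le> i \<and> i + l > J}" and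
          i = "\<lambda>(i, l, s). (i - s, s + l, s)" and j = "\<lambda>(a, b, s). (a + s, b - s, s)"])
      show "finite {(a, b, s). a \<le> J \<and> b \<le> J \<and> s \<le> b \<and> a + b > J}"
        by (rule finite_subset[of _ "{..J} \<times> {..J} \<times> {..J}"]) auto
      show "finite {(i, l, s). i \<le> J \<and> l \<le> J \<and> s \<le> i \<and> i + l > J}"
        by (rule finite_subset[of _ "{..J} \<times> {..J} \<times> {..J}"]) auto
    qed (auto simp: \<Phi>0)
    finally show "(\<Sum>a\<le>J. \<Sum>b\<le>J. \<Sum>s\<le>b.
        of_int (ibinom p (a + s) * ibinom q (b - s) * int ((a + s) choose s)) * \<Phi> p q a b)
      = (\<Sum>i\<le>J. \<Sum>l\<le>J. \<Sum>s\<le>i.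
      of_int (ibinom p i * ibinom q l * int (i choose s)) * \<Phi> p q (i - s) (s + l))"
      by (simp add: sum.Sigma)
  qed
  also have "\<dots> = (\<Sum>p\<in>P. \<Sum>i\<le>J. \<Sum>q\<in>P. \<Sum>l\<le>J. \<Sum>s\<le>i.
      of_int (ibinom p i * ibinom q l * int (i choose s)) * \<Phi> p q (i - s) (s + l))"
    by (intro sum.cong refl sum.swap)
  also have "\<dots> = (\<Sum>p\<in>P. \<Sum>i\<le>J. of_int (ibinom p i) * (cf A p *
      (D ^^ i) (\<Sum>q\<in>P. \<Sum>l\<le>J. of_int (ibinom q l) *
        (cf B q * (D ^^ l) (cf C (m - p + int i - q + int l))))))"
  proof (intro sum.cong refl)
    fix p i
    have eq: "(D ^^ i) (cf B q * (D ^^ l) (cf C (m - p + int i - q + int l)))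
      = (\<Sum>s\<le>i. of_nat (i choose s) * ((D ^^ (i - s)) (cf B q) *
          (D ^^ (s + l)) (cf C (m - p - q + int (i - s) + int (s + l)))))" for q l
      unfolding Dn_mult by (intro sum.cong refl) (simp add: funpow_add algebra_simps of_nat_diff)
    show "(\<Sum>q\<in>P. \<Sum>l\<le>J. \<Sum>s\<le>i.
        of_int (ibinom p i * ibinom q l * int (i choose s)) * \<Phi> p q (i - s) (s + l))
      = of_int (ibinom p i) * (cf A p * (D ^^ i) (\<Sum>q\<in>P. \<Sum>l\<le>J. of_int (ibinom q l) *
        (cf B q * (D ^^ l) (cf C (m - p + int i - q + int l)))))"
      unfolding Dn_sum Dn_of_int_mult eq by (simp add: sum_distrib_left \<Phi>_def mult_ac)
  qed
  also have "\<dots> = (\<Sum>p\<in>P. \<Sum>i\<le>J. of_int (ibinom p i) * (cf A p *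
      (D ^^ i) (cf (pmul B C) (m - p + int i))))"
  proof (intro sum.cong refl)
    fix p i assume p: "p \<in> P" and i: "i \<in> {..J}"
    show "of_int (ibinom p i) * (cf A p *
      (D ^^ i) (\<Sum>q\<in>P. \<Sum>l\<le>J. of_int (ibinom q l) *
        (cf B q * (D ^^ l) (cf C (m - p + int i - q + int l)))))
      = of_int (ibinom p i) * (cf A p * (D ^^ i) (cf (pmul B C) (m - p + int i)))"
      by (subst cf_pmul[OF oB oC, of P "m - p + int i" J]) (use p in \<open>auto simp: P_def J_def\<close>)
  qed
  also have "\<dots> = cf (pmul A (pmul B C)) m"
    using cf_pmul[OF oA order_le_pmul[OF oB oC], of P m J] by (simp add: P_def J_def)
  finally show "cf (pmul (pmul A B) C) m = cf (pmul A (pmul B C)) m" .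
qed

lemma pmul_add_right: "pmul A (B + C) = pmul A B + pmul A C"
proof (rule psd_eqI)
  fix m
  obtain NA NB NC where "order_le A NA" "order_le B NB" "order_le C NC"
    using order_le_ex by metis
  hence o: "order_le A NA" "order_le B (max NB NC)" "order_le C (max NB NC)"
    by (auto intro: order_le_mono)
  hence o': "order_le (B + C) (max NB NC)" by (simp add: order_le_def)
  show "cf (pmul A (B + C)) m = cf (pmul A B + pmul A C) m"
    unfolding cf_add cf_pmul[OF o(1) o' finite_atLeastAtMost_int order_refl order_refl]
      cf_pmul[OF o(1) o(2) finite_atLeastAtMost_int order_refl order_refl]
      cf_pmul[OF o(1) o(3) finite_atLeastAtMost_int order_refl order_refl]
    by (simp add: Dn_add sum.distrib distrib_left)
qed

lemma pmul_add_left: "pmul (A + B) C = pmul A C + pmul B C"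
proof (rule psd_eqI)
  fix m
  obtain NA NB NC where "order_le A NA" "order_le B NB" "order_le C NC"
    using order_le_ex by metis
  hence o: "order_le C NC" "order_le A (max NA NB)" "order_le B (max NA NB)"
    by (auto intro: order_le_mono)
  hence o': "order_le (A + B) (max NA NB)" by (simp add: order_le_def)
  show "cf (pmul (A + B) C) m = cf (pmul A C + pmul B C) m"
    unfolding cf_add cf_pmul[OF o' o(1) finite_atLeastAtMost_int order_refl order_refl]
      cf_pmul[OF o(2) o(1) finite_atLeastAtMost_int order_refl order_refl]
      cf_pmul[OF o(3) o(1) finite_atLeastAtMost_int order_refl order_refl]
    by (simp add: sum.distrib distrib_left distrib_right)
qed

lemma cf_pmul_function: "cf (pmul (monomial_op a 0) B) m = a * cf B m"
proof -
  from cf_pmul_ex[of "monomial_op a 0" B m] obtain P J where 1: "finite P"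
    "\<And>P' J'. finite P' \<Longrightarrow> P \<subseteq> P' \<Longrightarrow> J \<le> J' \<Longrightarrow> cf (pmul (monomial_op a 0) B) m
       = (\<Sum>k\<in>P'. \<Sum>j\<le>J'. of_int (ibinom k j) *
           (cf (monomial_op a 0) k * (D ^^ j) (cf B (m - k + int j))))"
    by blast
  have "cf (pmul (monomial_op a 0) B) m = (\<Sum>k\<in>insert 0 P. \<Sum>j\<le>J. of_int (ibinom k j) *
           (cf (monomial_op a 0) k * (D ^^ j) (cf B (m - k + int j))))"
    using 1(1) by (intro 1(2)) auto
  also have "\<dots> = (\<Sum>k\<in>insert 0 P. if k = 0 then (\<Sum>j\<le>J. of_int (ibinom 0 j) *
           (a * (D ^^ j) (cf B (m + int j)))) else 0)"
    by (intro sum.cong) (auto simp: cf_monomial_op)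
  also have "\<dots> = (\<Sum>j\<le>J. of_int (ibinom 0 j) * (a * (D ^^ j) (cf B (m + int j))))"
    using 1(1) by simp
  also have "\<dots> = (\<Sum>j\<le>J. if j = 0 then a * cf B m else 0)"
    by (intro sum.cong) (auto simp: ibinom_0_left)
  finally show ?thesis by simp
qed

lemma cf_pmul_D_power: "cf (pmul A (monomial_op 1 l)) m = cf A (m - l)"
proof -
  from cf_pmul_ex[of A "monomial_op 1 l" m] obtain P J where 1: "finite P"
    "\<And>P' J'. finite P' \<Longrightarrow> P \<subseteq> P' \<Longrightarrow> J \<le> J' \<Longrightarrow> cf (pmul A (monomial_op 1 l)) m
       = (\<Sum>k\<in>P'. \<Sum>j\<le>J'. of_int (ibinom k j) *
           (cf A k * (D ^^ j) (cf (monomial_op 1 l) (m - k + int j))))"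
    by blast
  have "cf (pmul A (monomial_op 1 l)) m = (\<Sum>k\<in>insert (m - l) P. \<Sum>j\<le>J. of_int (ibinom k j) *
           (cf A k * (D ^^ j) (cf (monomial_op 1 l) (m - k + int j))))"
    using 1(1) by (intro 1(2)) auto
  also have "\<dots> = (\<Sum>k\<in>insert (m - l) P. \<Sum>j\<le>J. if j = 0 then (if k = m - l then cf A k else 0) else 0)"
    by (intro sum.cong) (auto simp: cf_monomial_op Dn_1)
  also have "\<dots> = (\<Sum>k\<in>insert (m - l) P. if k = m - l then cf A k else 0)"
    by simp
  also have "\<dots> = cf A (m - l)"
    using 1(1) by (subst sum.delta) auto
  finally show ?thesis .
qed

lemma cf_pmul_D_left: "cf (pmul (monomial_op 1 1) B) m = cf B (m - 1) + D (cf B m)"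
proof -
  from cf_pmul_ex[of "monomial_op 1 1" B m] obtain P J where 1: "finite P"
    "\<And>P' J'. finite P' \<Longrightarrow> P \<subseteq> P' \<Longrightarrow> J \<le> J' \<Longrightarrow> cf (pmul (monomial_op 1 1) B) m
       = (\<Sum>k\<in>P'. \<Sum>j\<le>J'. of_int (ibinom k j) *
           (cf (monomial_op 1 1) k * (D ^^ j) (cf B (m - k + int j))))"
    by blast
  have "cf (pmul (monomial_op 1 1) B) m = (\<Sum>k\<in>insert 1 P. \<Sum>j\<le>Suc J. of_int (ibinom k j) *
           (cf (monomial_op 1 1) k * (D ^^ j) (cf B (m - k + int j))))"
    using 1(1) by (intro 1(2)) auto
  also have "\<dots> = (\<Sum>k\<in>insert 1 P. if k = 1 then (\<Sum>j\<le>Suc J. of_int (ibinom 1 j) *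
           ((D ^^ j) (cf B (m - 1 + int j)))) else 0)"
    by (intro sum.cong) (auto simp: cf_monomial_op)
  also have "\<dots> = (\<Sum>j\<le>Suc J. of_int (ibinom 1 j) * ((D ^^ j) (cf B (m - 1 + int j))))"
    using 1(1) by (simp del: sum.atMost_Suc)
  also have "\<dots> = (\<Sum>j\<le>Suc J. (if j = 0 then cf B (m - 1) else 0) + (if j = 1 then D (cf B m) else 0))"
    by (intro sum.cong) (auto simp: ibinom_1_left)
  also have "\<dots> = cf B (m - 1) + D (cf B m)"
    unfolding sum.distrib by (simp del: sum.atMost_Suc)
  finally show ?thesis .
qed

abbreviation pone :: "'a psd" where "pone \<equiv> monomial_op 1 0"

lemma pmul_one_left [simp]: "pmul pone A = A"
  by (rule psd_eqI) (simp add: cf_pmul_function)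

lemma pmul_one_right [simp]: "pmul A pone = A"
  by (rule psd_eqI) (simp add: cf_pmul_D_power)

sublocale psd: ring where plus = "(+)" and times = pmul and zero = 0 and minus = "(-)" and uminus = uminus
  by unfold_locales (simp_all add: pmul_assoc pmul_add_left pmul_add_right)

end

section \<open>Coefficients and differential parts of operators\<close>

definition coefs_in :: "'a::zero set \<Rightarrow> 'a psd \<Rightarrow> bool" where
  "coefs_in S A \<longleftrightarrow> (\<forall>m. cf A m \<in> S)"

lemma coefs_inD: "coefs_in S A \<Longrightarrow> cf A m \<in> S"
  by (simp add: coefs_in_def)

lift_definition ppart :: "'a::zero psd \<Rightarrow> 'a psd" is "\<lambda>A m. if m \<ge> 0 then A m else 0"
  by fastforce

lemma cf_ppart: "cf (ppart A) m = (if m \<ge> 0 then cf A m else 0)"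
  by transfer simp

definition fn :: "'a::zero \<Rightarrow> 'a psd" where "fn a = monomial_op a 0"

lemma cf_fn: "cf (fn a) m = (if m = 0 then a else 0)"
  by (simp add: fn_def cf_monomial_op)

lemma fn_minus: "fn (- a) = - fn a"
  by (rule psd_eqI) (simp add: cf_fn)

definition first_order_op :: "'a::comm_ring_1 \<Rightarrow> 'a psd" where
  "first_order_op a = monomial_op 1 1 + fn a"

lemma cf_first_order_op:
  "cf (first_order_op a) m = (if m = 1 then 1 else if m = 0 then a else 0)"
  by (simp add: first_order_op_def cf_fn cf_monomial_op)

lemma order_le_first_order_op: "order_le (first_order_op a) 1"
  by (simp add: order_le_def cf_first_order_op)

text \<open>The derivation is only required to be one on the subring \<open>C\<close>, but its values may lie outside:
  below, \<open>C\<close> consists of the elements free of the test function, and the values are linear in it.\<close>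

locale derivation_on =
  derivation D for D :: "'a::comm_ring_1 \<Rightarrow> 'a" +
  fixes C :: "'a set" and \<delta> :: "'a \<Rightarrow> 'a"
  assumes C_0: "0 \<in> C" and C_add: "x \<in> C \<Longrightarrow> y \<in> C \<Longrightarrow> x + y \<in> C"
    and C_minus: "x \<in> C \<Longrightarrow> - x \<in> C"
    and C_mult: "x \<in> C \<Longrightarrow> y \<in> C \<Longrightarrow> x * y \<in> C"
    and C_D: "x \<in> C \<Longrightarrow> D x \<in> C"
    and \<delta>_add: "x \<in> C \<Longrightarrow> y \<in> C \<Longrightarrow> \<delta> (x + y) = \<delta> x + \<delta> y"
    and \<delta>_mult: "x \<in> C \<Longrightarrow> y \<in> C \<Longrightarrow> \<delta> (x * y) = \<delta> x * y + x * \<delta> y"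
    and \<delta>_D: "x \<in> C \<Longrightarrow> \<delta> (D x) = D (\<delta> x)"

context derivation
begin

text \<open>The three sets allow for modules as well as for subrings: \<open>U\<close> may be a module over \<open>S\<close> or over \<open>T\<close>.\<close>

lemma coefs_in_pmul:
  assumes A: "coefs_in S A" and B: "coefs_in T B"
    and U: "0 \<in> U" "\<And>x y. x \<in> U \<Longrightarrow> y \<in> U \<Longrightarrow> x + y \<in> U" "\<And>x. x \<in> U \<Longrightarrow> - x \<in> U"
    and ST: "\<And>x y j. x \<in> S \<Longrightarrow> y \<in> T \<Longrightarrow> x * (D ^^ j) y \<in> U"
  shows "coefs_in U (pmul A B)"
proof -
  have sumU: "sum g I \<in> U" if "\<And>i. i \<in> I \<Longrightarrow> g i \<in> U" for g :: "int \<times> nat \<Rightarrow> 'a" and I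
    using that by (induction I rule: infinite_finite_induct) (auto simp: U)
  have natU: "of_nat c * x \<in> U" if "x \<in> U" for c x
    using that by (induction c) (auto simp: U algebra_simps)
  have intU: "of_int c * x \<in> U" if "x \<in> U" for c x
    by (cases c rule: int_cases2) (use that natU U(3) in auto)
  show ?thesis
    unfolding coefs_in_def cf_pmul_support
    by (intro allI sumU) (auto simp: pterm_def intro!: intU ST coefs_inD[OF A] coefs_inD[OF B])
qed

text \<open>Differential operators form a subring since \<open>k choose j\<close> vanishes for \<open>0 \<le> k < j\<close>.\<close>

lemma pmul_differential:
  assumes "\<And>m. m < 0 \<Longrightarrow> cf A m = 0" "\<And>m. m < 0 \<Longrightarrow> cf B m = 0" "m < 0"
  shows "cf (pmul A B) m = 0"
proof -
  have "pterm A B m k j = 0" for k j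
  proof (cases "k < 0 \<or> m - k + int j < 0")
    case True
    thus ?thesis using assms(1,2) by (auto simp: pterm_def)
  next
    case False
    then obtain k' where "k = int k'" "k' < j" using assms(3) by (cases k) auto
    thus ?thesis by (simp add: pterm_def ibinom_of_nat binomial_eq_0)
  qed
  thus ?thesis by (simp add: cf_pmul_support)
qed

lemma order_le_negative_part: "order_le (A - ppart A) (-1)"
  by (simp add: order_le_def cf_ppart)

text \<open>Split \<open>H\<close> into its differential part and a part of order at most \<open>-1\<close>. The product of a monic
  first-order operator with the former is differential, the one with the latter has order at most \<open>0\<close>,
  and its coefficient of \<open>\<partial>^0\<close> is the residue of \<open>H\<close>. The same holds for products in the other order.\<close>

lemma ppart_first_order_left:
  "ppart (pmul (first_order_op a) H) = pmul (first_order_op a) (ppart H) + fn (cf H (-1))"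
proof (rule psd_eqI)
  fix m
  let ?Q = "first_order_op a"
  have 1: "cf (pmul ?Q H) m = cf (pmul ?Q (ppart H)) m + cf (pmul ?Q (H - ppart H)) m"
    by (simp add: psd.right_diff_distrib)
  have 2: "m < 0 \<Longrightarrow> cf (pmul ?Q (ppart H)) m = 0"
    by (rule pmul_differential) (simp_all add: cf_first_order_op cf_ppart)
  have 3: "m > 0 \<Longrightarrow> cf (pmul ?Q (H - ppart H)) m = 0"
    using order_le_pmul[OF order_le_first_order_op[of a] order_le_negative_part[of H]]
    by (auto simp: order_le_def)
  have 4: "cf (pmul ?Q (H - ppart H)) 0 = cf H (-1)"
    using cf_pmul_top[OF order_le_first_order_op[of a] order_le_negative_part[of H]]
    by (simp add: cf_first_order_op cf_ppart)
  show "cf (ppart (pmul ?Q H)) m = cf (pmul ?Q (ppart H) + fn (cf H (-1))) m"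
    using 1 2 3 4 by (cases m "0 :: int" rule: linorder_cases) (simp_all add: cf_ppart cf_fn)
qed

lemma ppart_first_order_right:
  "ppart (pmul H (first_order_op a)) = pmul (ppart H) (first_order_op a) + fn (cf H (-1))"
proof (rule psd_eqI)
  fix m
  let ?Q = "first_order_op a"
  have 1: "cf (pmul H ?Q) m = cf (pmul (ppart H) ?Q) m + cf (pmul (H - ppart H) ?Q) m"
    by (simp add: psd.left_diff_distrib)
  have 2: "m < 0 \<Longrightarrow> cf (pmul (ppart H) ?Q) m = 0"
    by (rule pmul_differential) (simp_all add: cf_first_order_op cf_ppart)
  have 3: "m > 0 \<Longrightarrow> cf (pmul (H - ppart H) ?Q) m = 0"
    using order_le_pmul[OF order_le_negative_part[of H] order_le_first_order_op[of a]]
    by (auto simp: order_le_def)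
  have 4: "cf (pmul (H - ppart H) ?Q) 0 = cf H (-1)"
    using cf_pmul_top[OF order_le_negative_part[of H] order_le_first_order_op[of a]]
    by (simp add: cf_first_order_op cf_ppart)
  show "cf (ppart (pmul H ?Q)) m = cf (pmul (ppart H) ?Q + fn (cf H (-1))) m"
    using 1 2 3 4 by (cases m "0 :: int" rule: linorder_cases) (simp_all add: cf_ppart cf_fn)
qed

lemma pmul_fn_left: "cf (pmul (fn a) B) m = a * cf B m"
  by (simp add: fn_def cf_pmul_function)

lemma pmul_fn_first_order: "pmul (fn h) (first_order_op a) = pmul (first_order_op a) (fn h) - fn (D h)"
  by (rule psd_eqI)
    (auto simp: first_order_op_def psd.distrib_left psd.distrib_right cf_pmul_D_left
      pmul_fn_left cf_fn cf_monomial_op)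

section \<open>The Adler formula for factors of an operator\<close>

text \<open>The formula for the variation of a factor \<open>P\<close> of \<open>X P Y\<close>. For \<open>X = Y = 1\<close> it is
  \<open>d P = P (F P)\<^sub>+ - (P F)\<^sub>+ P\<close>; in general \<open>F\<close> is replaced by \<open>Y F X\<close>, the remaining factors in
  cyclic order.\<close>

definition adler :: "'a psd \<Rightarrow> ('a psd \<Rightarrow> 'a psd) \<Rightarrow> 'a psd \<Rightarrow> 'a psd \<Rightarrow> 'a psd \<Rightarrow> bool" where
  "adler F d X P Y \<longleftrightarrow>
     d P = pmul P (ppart (pmul (pmul Y F) (pmul X P))) - pmul (ppart (pmul (pmul P Y) (pmul F X))) P"

text \<open>The term \<open>P (P' Y F X P)\<^sub>+ P'\<close> occurs in \<open>d P P'\<close> and, with the opposite sign, in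
  \<open>P d P'\<close>; the other two terms are those of the product.\<close>

lemma adler_pmul:
  assumes "d (pmul P P') = pmul (d P) P' + pmul P (d P')"
    and "adler F d X P (pmul P' Y)" and "adler F d (pmul X P) P' Y"
  shows "adler F d X (pmul P P') Y"
  using assms unfolding adler_def
  by (simp add: psd.left_diff_distrib psd.right_diff_distrib psd.mult_assoc)

text \<open>With \<open>Q = \<partial> + a\<close> and \<open>H = Y F X\<close> the right-hand side of the formula is
  \<open>Q (H Q)\<^sub>+ - (Q H)\<^sub>+ Q = Q h - h Q\<close> with \<open>h = Res H\<close>, a commutator equal to \<open>D h\<close>.\<close>

lemma adler_first_order:
  assumes "d (first_order_op a) = fn (D (cf (pmul (pmul Y F) X) (-1)))"
  shows "adler F d X (first_order_op a) Y"
proof -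
  let ?H = "pmul (pmul Y F) X" and ?Q = "first_order_op a"
  have 1: "pmul (pmul Y F) (pmul X ?Q) = pmul ?H ?Q"
    and 2: "pmul (pmul ?Q Y) (pmul F X) = pmul ?Q ?H"
    by (simp_all add: psd.mult_assoc)
  show ?thesis
    unfolding adler_def 1 2 ppart_first_order_left ppart_first_order_right assms
    by (simp add: psd.distrib_left psd.distrib_right psd.mult_assoc pmul_fn_first_order)
qed

text \<open>With \<open>Q = \<partial> + a\<close> and \<open>H = R F X R\<close> the right-hand side is \<open>R (Q H)\<^sub>+ - (H Q)\<^sub>+ R = R h - h R\<close> with
  \<open>h = Res H\<close>. This equals \<open>- R (Q h - h Q) R\<close>, so that the variation of \<open>a\<close> has to be
  \<open>+ D h\<close>, whereas for a factor \<open>\<partial> - a\<close> it has to be \<open>- D h\<close>.\<close>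

lemma adler_inverse_first_order:
  assumes RQ: "pmul R (first_order_op a) = pone" and QR: "pmul (first_order_op a) R = pone"
    and d: "d R = - pmul R (pmul (fn (D (cf (pmul R (pmul F (pmul X R))) (-1)))) R)"
  shows "adler F d X R pone"
proof -
  let ?H = "pmul R (pmul F (pmul X R))" and ?Q = "first_order_op a"
  have 1: "pmul (pmul pone F) (pmul X R) = pmul ?Q ?H"
    using QR by (simp add: psd.mult_assoc[symmetric])
  have "pmul ?H ?Q = pmul R (pmul F (pmul X (pmul R ?Q)))"
    by (simp only: psd.mult_assoc)
  hence 2: "pmul (pmul R pone) (pmul F X) = pmul ?H ?Q"
    using RQ by simp
  let ?h = "cf ?H (-1)"
  have 3: "fn (D ?h) = pmul ?Q (fn ?h) - pmul (fn ?h) ?Q"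
    by (simp add: pmul_fn_first_order)
  have a: "pmul R (pmul ?Q A) = A" for A
    using RQ by (simp add: psd.mult_assoc[symmetric])
  show ?thesis
    unfolding adler_def 1 2 ppart_first_order_left ppart_first_order_right d 3
    by (simp add: psd.distrib_left psd.distrib_right psd.left_diff_distrib psd.right_diff_distrib
        psd.mult_assoc a QR)
qed

section \<open>Adjoints of derivatives and derivations of the ring of operators\<close>

text \<open>The formal adjoint of \<open>w \<mapsto> D^j (z w)\<close> is \<open>z (- D)^j\<close>. The left-hand side is the adjoint computed
  after expanding \<open>D^j (z w)\<close> by the Leibniz rule.\<close>

lemma sum_binomial_adjoint:
  "(\<Sum>i\<le>j. (-1) ^ i * of_nat (j choose i) * (D ^^ i) ((D ^^ (j - i)) z * w))
   = (-1) ^ j * (z * (D ^^ j) w)"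
proof (induction j arbitrary: z)
  case (Suc j)
  let ?t = "\<lambda>c i. (-1) ^ i * of_nat c * (D ^^ i) ((D ^^ (Suc j - i)) z * w)"
  have "(\<Sum>i\<le>Suc j. ?t (Suc j choose i) i)
      = (\<Sum>i\<le>Suc j. ?t (j choose i) i) + (\<Sum>i\<le>j. ?t (j choose i) (Suc i))"
    by (simp only: sum.atMost_Suc_shift)
      (simp add: sum.distrib[symmetric] algebra_simps del: sum.atMost_Suc)
  also have "(\<Sum>i\<le>Suc j. ?t (j choose i) i)
      = (\<Sum>i\<le>j. (-1) ^ i * of_nat (j choose i) * (D ^^ i) ((D ^^ (j - i)) (D z) * w))"
    by (simp add: binomial_eq_0 Suc_diff_le funpow_swap1)
  also have "\<dots> = (-1) ^ j * (D z * (D ^^ j) w)"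
    by (rule Suc)
  also have "(\<Sum>i\<le>j. ?t (j choose i) (Suc i))
      = - D (\<Sum>i\<le>j. (-1) ^ i * of_nat (j choose i) * (D ^^ i) ((D ^^ (j - i)) z * w))"
  proof -
    have "D ((-1) ^ i * of_nat c * x) = (-1) ^ i * of_nat c * D x" for i c x
    proof -
      have "(-1) ^ i * of_nat c = (of_int ((-1) ^ i * int c) :: 'a)" by simp
      thus ?thesis by (simp only: D_mult D_of_int) simp
    qed
    thus ?thesis by (simp add: D_sum sum_negf[symmetric])
  qed
  also have "\<dots> = - D ((-1) ^ j * (z * (D ^^ j) w))"
    by (simp only: Suc)
  also have "\<dots> = - ((-1) ^ j * (D z * (D ^^ j) w + z * D ((D ^^ j) w)))"
    by (cases "even j") (simp_all add: D_mult D_minus)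
  finally show ?case by (simp add: algebra_simps)
qed auto

end

context derivation_on
begin

lemma \<delta>_0: "\<delta> 0 = 0"
  using \<delta>_add[OF C_0 C_0] by simp

lemma \<delta>_minus: "x \<in> C \<Longrightarrow> \<delta> (- x) = - \<delta> x"
  using \<delta>_add[of x "- x"] C_minus[of x] \<delta>_0 by (simp add: eq_neg_iff_add_eq_0 add.commute)

lemma \<delta>_sum: "(\<And>i. i \<in> I \<Longrightarrow> g i \<in> C) \<Longrightarrow> sum g I \<in> C \<and> \<delta> (sum g I) = (\<Sum>i\<in>I. \<delta> (g i))"
  by (induction I rule: infinite_finite_induct) (auto simp: \<delta>_add \<delta>_0 C_0 C_add)

lemma \<delta>_of_nat_mult: "x \<in> C \<Longrightarrow> of_nat c * x \<in> C \<and> \<delta> (of_nat c * x) = of_nat c * \<delta> x"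
  by (induction c) (auto simp: C_0 C_add \<delta>_0 \<delta>_add algebra_simps)

lemma \<delta>_of_int_mult: "x \<in> C \<Longrightarrow> of_int c * x \<in> C \<and> \<delta> (of_int c * x) = of_int c * \<delta> x"
  by (cases c rule: int_cases2) (auto simp: \<delta>_of_nat_mult C_minus \<delta>_minus)

lemma \<delta>_Dn: "x \<in> C \<Longrightarrow> (D ^^ j) x \<in> C \<and> \<delta> ((D ^^ j) x) = (D ^^ j) (\<delta> x)"
  by (induction j) (auto simp: C_D \<delta>_D)

definition ext :: "'a psd \<Rightarrow> 'a psd" where
  "ext A = Psd (\<lambda>m. \<delta> (cf A m))"

lemma cf_ext: "cf (ext A) m = \<delta> (cf A m)"
proof -
  obtain N where "order_le A N" using order_le_ex by blast
  hence "(\<lambda>m. \<delta> (cf A m)) \<in> {A. \<exists>N. \<forall>m>N. A m = 0}"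
    by (auto simp: order_le_def \<delta>_0 intro!: exI[of _ N])
  thus ?thesis by (simp add: ext_def Psd_inverse)
qed

text \<open>The product of operators is built from products and derivatives of coefficients with integer
  factors, and all of these are respected by a derivation that commutes with \<open>D\<close>.\<close>

lemma ext_pmul:
  assumes A: "coefs_in C A" and B: "coefs_in C B"
  shows "ext (pmul A B) = pmul (ext A) B + pmul A (ext B)"
proof (rule psd_eqI)
  fix m
  obtain N M where NM: "order_le A N" "order_le B M" using order_le_ex by metis
  hence NM': "order_le (ext A) N" "order_le (ext B) M"
    by (auto simp: order_le_def cf_ext \<delta>_0)
  note fin = finite_atLeastAtMost_int order_refl order_refl
  have C: "cf A k * (D ^^ j) (cf B l) \<in> C" for k j l
    using A B by (intro C_mult) (auto simp: coefs_in_def \<delta>_Dn)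
  have "cf (ext (pmul A B)) m = (\<Sum>k=m-M..N. \<Sum>j\<le>nat (N + M - m).
      of_int (ibinom k j) * \<delta> (cf A k * (D ^^ j) (cf B (m - k + int j))))"
    unfolding cf_ext cf_pmul[OF NM fin]
    using C by (simp add: \<delta>_sum \<delta>_of_int_mult)
  also have "\<dots> = cf (pmul (ext A) B + pmul A (ext B)) m"
    unfolding cf_add cf_pmul[OF NM'(1) NM(2) fin] cf_pmul[OF NM(1) NM'(2) fin]
    using A B by (simp add: \<delta>_mult \<delta>_Dn coefs_in_def cf_ext sum.distrib distrib_left)
  finally show "cf (ext (pmul A B)) m = cf (pmul (ext A) B + pmul A (ext B)) m" .
qed

end

section \<open>Test functions and formal adjoints\<close>

text \<open>The elements \<open>D^k f\<close> are linearly independent over the subring \<open>C\<close>, as witnessed by the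
  coefficient functionals \<open>fc\<close>. The form \<open>\<Sum>k. c\<^sub>k D^k f\<close> stands for the differential operator
  \<open>\<Sum>k. c\<^sub>k D^k\<close> as well as for the polynomial \<open>\<Sum>k. c\<^sub>k \<lambda>^k\<close>.\<close>

locale test_function =
  derivation D for D :: "'a::comm_ring_1 \<Rightarrow> 'a" +
  fixes C :: "'a set" and f :: 'a and fc :: "nat \<Rightarrow> 'a \<Rightarrow> 'a"
  assumes C_1: "1 \<in> C" and C_add: "x \<in> C \<Longrightarrow> y \<in> C \<Longrightarrow> x + y \<in> C"
    and C_minus: "x \<in> C \<Longrightarrow> - x \<in> C"
    and C_mult: "x \<in> C \<Longrightarrow> y \<in> C \<Longrightarrow> x * y \<in> C"
    and C_D: "x \<in> C \<Longrightarrow> D x \<in> C"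
    and fc_add: "fc k (x + y) = fc k x + fc k y"
    and fc_test: "c \<in> C \<Longrightarrow> fc k (c * (D ^^ l) f) = (if k = l then c else 0)"
begin

lemma C_0: "0 \<in> C"
  using C_add[OF C_1 C_minus[OF C_1]] by simp

lemma C_of_nat: "of_nat c \<in> C"
  by (induction c) (auto simp: C_0 C_1 C_add)

lemma C_Dn: "x \<in> C \<Longrightarrow> (D ^^ j) x \<in> C"
  by (induction j) (auto simp: C_D)

lemma fc_0: "fc k 0 = 0"
  using fc_add[of k 0 0] by simp

lemma fc_minus: "fc k (- x) = - fc k x"
  using fc_add[of k x "- x"] by (simp add: fc_0 eq_neg_iff_add_eq_0 add.commute)

lemma fc_sum: "fc k (sum g I) = (\<Sum>i\<in>I. fc k (g i))"
  by (induction I rule: infinite_finite_induct) (auto simp: fc_0 fc_add)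

lemma fc_of_nat_mult: "fc k (of_nat c * x) = of_nat c * fc k x"
  by (induction c) (auto simp: fc_0 fc_add algebra_simps)

lemma fc_of_int_mult: "fc k (of_int c * x) = of_int c * fc k x"
  by (cases c rule: int_cases2) (simp_all add: fc_of_nat_mult fc_minus)

inductive_set forms :: "'a set \<Rightarrow> 'a set" for S where
  forms_0: "0 \<in> forms S"
| forms_add_term: "c \<in> S \<Longrightarrow> t \<in> forms S \<Longrightarrow> c * (D ^^ k) f + t \<in> forms S"

lemma forms_term: "c \<in> S \<Longrightarrow> c * (D ^^ k) f \<in> forms S"
  using forms_add_term[OF _ forms_0] by simp

lemma forms_add: "t \<in> forms S \<Longrightarrow> t' \<in> forms S \<Longrightarrow> t + t' \<in> forms S"
  by (induction rule: forms.induct) (auto simp: add.assoc intro: forms_add_term)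

lemma forms_sum: "(\<And>i. i \<in> I \<Longrightarrow> g i \<in> forms S) \<Longrightarrow> sum g I \<in> forms S"
  by (induction I rule: infinite_finite_induct) (auto intro: forms_0 forms_add)

lemma forms_minus: "t \<in> forms S \<Longrightarrow> (\<And>c. c \<in> S \<Longrightarrow> - c \<in> S) \<Longrightarrow> - t \<in> forms S"
proof (induction t rule: forms.induct)
  case (forms_add_term c t k)
  thus ?case using forms.forms_add_term[of "- c" S "- t" k] by (simp add: add.commute)
qed (auto intro: forms_0)

lemma forms_mult: "t \<in> forms S \<Longrightarrow> (\<And>c. c \<in> S \<Longrightarrow> x * c \<in> S) \<Longrightarrow> x * t \<in> forms S"
proof (induction t rule: forms.induct)
  case (forms_add_term c t k)
  thus ?case using forms.forms_add_term[of "x * c" S "x * t" k] by (simp add: algebra_simps)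
qed (auto intro: forms_0)

lemma forms_D: "t \<in> forms S \<Longrightarrow> (\<And>c. c \<in> S \<Longrightarrow> D c \<in> S) \<Longrightarrow> D t \<in> forms S"
proof (induction t rule: forms.induct)
  case (forms_add_term c t k)
  have "D c * (D ^^ k) f + (c * (D ^^ Suc k) f + D t) \<in> forms S"
    using forms_add_term by (intro forms.forms_add_term) auto
  thus ?case by (simp add: D_add D_mult algebra_simps)
qed (auto intro: forms_0)

lemma forms_Dn: "t \<in> forms S \<Longrightarrow> (\<And>c. c \<in> S \<Longrightarrow> D c \<in> S) \<Longrightarrow> (D ^^ j) t \<in> forms S"
  by (induction j) (auto intro: forms_D)

lemma fc_in:
  assumes "S \<subseteq> C" "0 \<in> S" "\<And>x y. x \<in> S \<Longrightarrow> y \<in> S \<Longrightarrow> x + y \<in> S"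
  shows "t \<in> forms S \<Longrightarrow> fc k t \<in> S"
proof (induction t rule: forms.induct)
  case (forms_add_term c t l)
  hence "c \<in> C" using assms(1) by auto
  thus ?case using forms_add_term assms by (simp add: fc_add fc_test)
qed (simp add: fc_0 assms)

lemma finite_fc: "t \<in> forms C \<Longrightarrow> finite {k. fc k t \<noteq> 0}"
proof (induction t rule: forms.induct)
  case (forms_add_term c t l)
  have "{k. fc k (c * (D ^^ l) f + t) \<noteq> 0} \<subseteq> insert l {k. fc k t \<noteq> 0}"
    using forms_add_term by (auto simp: fc_add fc_test)
  thus ?case using forms_add_term finite_subset by blast
qed (simp add: fc_0)

text \<open>The formal adjoint of the differential operator given by a form, applied to \<open>f\<close>.\<close>

definition Ad :: "'a \<Rightarrow> 'a" where
  "Ad t = (\<Sum>k | fc k t \<noteq> 0. (-1) ^ k * (D ^^ k) (fc k t * f))"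

lemma Ad_superset:
  assumes "finite K" "{k. fc k t \<noteq> 0} \<subseteq> K"
  shows "Ad t = (\<Sum>k\<in>K. (-1) ^ k * (D ^^ k) (fc k t * f))"
  unfolding Ad_def using assms by (intro sum.mono_neutral_left) auto

lemma Ad_0: "Ad 0 = 0"
  by (simp add: Ad_def fc_0)

lemma Ad_add:
  assumes "t \<in> forms C" "t' \<in> forms C"
  shows "Ad (t + t') = Ad t + Ad t'"
proof -
  let ?K = "{k. fc k t \<noteq> 0} \<union> {k. fc k t' \<noteq> 0}"
  have K: "finite ?K" using assms by (auto simp: finite_fc)
  have "Ad (t + t') = (\<Sum>k\<in>?K. (-1) ^ k * (D ^^ k) (fc k (t + t') * f))"
    by (rule Ad_superset[OF K]) (auto simp: fc_add)
  also have "\<dots> = (\<Sum>k\<in>?K. (-1) ^ k * (D ^^ k) (fc k t * f))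
      + (\<Sum>k\<in>?K. (-1) ^ k * (D ^^ k) (fc k t' * f))"
    by (simp add: fc_add Dn_add distrib_right distrib_left sum.distrib)
  also have "\<dots> = Ad t + Ad t'"
    by (intro arg_cong2[where f = "(+)"] Ad_superset[OF K, symmetric]) auto
  finally show ?thesis .
qed

lemma Ad_sum:
  "(\<And>i. i \<in> I \<Longrightarrow> g i \<in> forms C) \<Longrightarrow> Ad (sum g I) = (\<Sum>i\<in>I. Ad (g i))"
  by (induction I rule: infinite_finite_induct) (auto simp: Ad_0 Ad_add forms_sum)

lemma Ad_of_int_mult:
  assumes "t \<in> forms C"
  shows "Ad (of_int c * t) = of_int c * Ad t"
proof -
  have "{k. fc k (of_int c * t) \<noteq> 0} \<subseteq> {k. fc k t \<noteq> 0}"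
    by (auto simp: fc_of_int_mult)
  hence "Ad (of_int c * t) = (\<Sum>k | fc k t \<noteq> 0. (-1) ^ k * (D ^^ k) (fc k (of_int c * t) * f))"
    using finite_fc[OF assms] by (intro Ad_superset)
  thus ?thesis
    by (simp add: Ad_def fc_of_int_mult mult.assoc Dn_of_int_mult sum_distrib_left mult.left_commute)
qed

lemma Ad_term: "c \<in> C \<Longrightarrow> Ad (c * (D ^^ k) f) = (-1) ^ k * (D ^^ k) (c * f)"
  by (subst Ad_superset[of "{k}"]) (auto simp: fc_test)

text \<open>The form \<open>x D^j (z D f)\<close> belongs to the operator \<open>x D^j z D\<close>, whose adjoint is \<open>- D z (- D)^j x\<close>.\<close>

lemma Ad_twisted:
  assumes x: "x \<in> C" and z: "z \<in> C"
  shows "Ad (x * (D ^^ j) (D f * z)) = - D ((-1) ^ j * (z * (D ^^ j) (f * x)))"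
proof -
  have "x * (D ^^ j) (D f * z)
      = (\<Sum>i\<le>j. (of_nat (j choose i) * (x * (D ^^ (j - i)) z)) * (D ^^ Suc i) f)"
    unfolding mult.commute[of "D f"] Dn_mult
    by (simp add: sum_distrib_left funpow_swap1 mult_ac)
  hence "Ad (x * (D ^^ j) (D f * z))
      = (\<Sum>i\<le>j. Ad ((of_nat (j choose i) * (x * (D ^^ (j - i)) z)) * (D ^^ Suc i) f))"
    using x z by (simp add: Ad_sum forms_term C_mult C_of_nat C_Dn del: funpow.simps)
  also have "\<dots> = (\<Sum>i\<le>j. (-1) ^ Suc i *
      (D ^^ Suc i) ((of_nat (j choose i) * (x * (D ^^ (j - i)) z)) * f))"
    using x z by (intro sum.cong refl Ad_term) (auto intro!: C_mult C_of_nat C_Dn)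
  also have "\<dots> = - D (\<Sum>i\<le>j. (-1) ^ i * of_nat (j choose i) *
      (D ^^ i) ((D ^^ (j - i)) z * (f * x)))"
  proof -
    have "(-1) ^ Suc i * (D ^^ Suc i) ((of_nat (j choose i) * (x * (D ^^ (j - i)) z)) * f)
        = - D ((-1) ^ i * of_nat (j choose i) * (D ^^ i) ((D ^^ (j - i)) z * (f * x)))" for i
    proof -
      let ?y = "(D ^^ (j - i)) z * (f * x)"
      have c: "(of_int ((-1) ^ i * int (j choose i)) :: 'a) = (-1) ^ i * of_nat (j choose i)"
        by simp
      have "(-1) ^ Suc i * (D ^^ Suc i) ((of_nat (j choose i) * (x * (D ^^ (j - i)) z)) * f)
        = (-1) ^ Suc i * (D ^^ Suc i) (of_int (int (j choose i)) * ?y)"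
        by (simp add: mult_ac)
      also have "\<dots> = - (of_int ((-1) ^ i * int (j choose i)) * D ((D ^^ i) ?y))"
        unfolding Dn_of_int_mult by (simp add: mult_ac)
      also have "\<dots> = - D (of_int ((-1) ^ i * int (j choose i)) * (D ^^ i) ?y)"
        by (simp only: D_mult D_of_int) simp
      finally show ?thesis unfolding c .
    qed
    thus ?thesis by (simp add: D_sum sum_negf)
  qed
  also have "\<dots> = - D ((-1) ^ j * (z * (D ^^ j) (f * x)))"
    by (simp only: sum_binomial_adjoint)
  finally show ?thesis .
qed

text \<open>Taking adjoints reverses the cyclic order inside a residue. Termwise this is \<open>Ad_twisted\<close>; the
  sign \<open>(-1)^j\<close> that it produces is absorbed by
  \<open>ibinom k j = (-1)^j * ibinom (j - k - 1) j\<close>, and \<open>j - k - 1\<close> is the index of the coefficient of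
  \<open>Z\<close> that meets the coefficient of \<open>X\<close> with index \<open>k\<close> in the residue.\<close>

lemma Ad_residue:
  assumes X: "coefs_in C X" and Z: "coefs_in C Z"
  shows "Ad (cf (pmul X (pmul (fn (D f)) Z)) (-1)) = - D (cf (pmul Z (pmul (fn f) X)) (-1))"
proof -
  obtain N M where NM: "order_le X N" "order_le Z M" using order_le_ex by metis
  have o1: "order_le (pmul (fn (D f)) Z) M" and o2: "order_le (pmul (fn f) X) N"
    using NM by (auto simp: order_le_def pmul_fn_left)
  note fin = finite_atLeastAtMost_int order_refl order_refl
  let ?J = "nat (N + M + 1)"
  have C: "cf X k \<in> C" "cf Z k \<in> C" for k
    using X Z by (auto simp: coefs_in_def)
  have form: "x * (D ^^ j) (D f * z) \<in> forms C" if "x \<in> C" "z \<in> C" for x z j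
  proof -
    have "D f * z \<in> forms C"
      using forms_term[of z C 1] that by (simp add: mult.commute)
    hence "(D ^^ j) (D f * z) \<in> forms C" by (rule forms_Dn) (rule C_D)
    thus ?thesis by (rule forms_mult) (rule C_mult[OF that(1)])
  qed
  have "Ad (cf (pmul X (pmul (fn (D f)) Z)) (-1))
      = Ad (\<Sum>k = -1 - M..N. \<Sum>j\<le>?J. of_int (ibinom k j) *
          (cf X k * (D ^^ j) (D f * cf Z (-1 - k + int j))))"
    unfolding cf_pmul[OF NM(1) o1 fin] by (simp add: pmul_fn_left algebra_simps)
  also have "\<dots> = (\<Sum>k = -1 - M..N. \<Sum>j\<le>?J. Ad (of_int (ibinom k j) *
          (cf X k * (D ^^ j) (D f * cf Z (-1 - k + int j)))))"
  proof -
    have *: "of_int c * t \<in> forms C" if "t \<in> forms C" for c t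
      by (cases c rule: int_cases2)
        (use that in \<open>auto intro!: forms_minus forms_mult intro: C_minus C_mult C_of_nat\<close>)
    show ?thesis by (simp add: Ad_sum form C * forms_sum)
  qed
  also have "\<dots> = (\<Sum>k = -1 - M..N. \<Sum>j\<le>?J. of_int (ibinom k j) *
          - D ((-1) ^ j * (cf Z (-1 - k + int j) * (D ^^ j) (f * cf X k))))"
    by (simp add: Ad_of_int_mult form C Ad_twisted)
  also have "\<dots> = (\<Sum>j\<le>?J. \<Sum>k = -1 - M..N. of_int (ibinom k j) *
          - D ((-1) ^ j * (cf Z (-1 - k + int j) * (D ^^ j) (f * cf X k))))"
    by (rule sum.swap)
  also have "\<dots> = (\<Sum>j\<le>?J. \<Sum>l = -1 - N..M. of_int (ibinom l j) *
          - D (cf Z l * (D ^^ j) (f * cf X (-1 - l + int j))))"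
  proof (rule sum.cong[OF refl])
    fix j assume j: "j \<in> {..?J}"
    show "(\<Sum>k = -1 - M..N. of_int (ibinom k j) *
          - D ((-1) ^ j * (cf Z (-1 - k + int j) * (D ^^ j) (f * cf X k))))
      = (\<Sum>l = -1 - N..M. of_int (ibinom l j) *
          - D (cf Z l * (D ^^ j) (f * cf X (-1 - l + int j))))"
    proof (rule sum.reindex_bij_witness_not_neutral[where
          S' = "{k \<in> {-1 - M..N}. -1 - k + int j \<notin> {-1 - N..M}}" and
          T' = "{l \<in> {-1 - N..M}. -1 - l + int j \<notin> {-1 - M..N}}" and
          i = "\<lambda>l. -1 - l + int j" and j = "\<lambda>k. -1 - k + int j"])
      fix k assume "k \<in> {-1 - M..N}"
      have b: "ibinom (-1 - k + int j) j = (-1) ^ j * ibinom k j"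
        using ibinom_negated_upper[of k j]
        by (simp add: algebra_simps power_mult_distrib[symmetric] mult.assoc[symmetric])
      show "of_int (ibinom (-1 - k + int j) j) *
          - D (cf Z (-1 - k + int j) * (D ^^ j) (f * cf X (-1 - (-1 - k + int j) + int j)))
        = of_int (ibinom k j) *
          - D ((-1) ^ j * (cf Z (-1 - k + int j) * (D ^^ j) (f * cf X k)))"
        unfolding b by (cases "even j") (simp_all add: D_minus)
    next
      fix k assume "k \<in> {k \<in> {-1 - M..N}. -1 - k + int j \<notin> {-1 - N..M}}"
      hence "-1 - k + int j > M" by auto
      thus "of_int (ibinom k j) *
          - D ((-1) ^ j * (cf Z (-1 - k + int j) * (D ^^ j) (f * cf X k))) = 0"
        using NM by (simp add: order_leD)
    next
      fix l assume "l \<in> {l \<in> {-1 - N..M}. -1 - l + int j \<notin> {-1 - M..N}}"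
      hence "-1 - l + int j > N" by auto
      thus "of_int (ibinom l j) * - D (cf Z l * (D ^^ j) (f * cf X (-1 - l + int j))) = 0"
        using NM by (simp add: order_leD)
    next
      show "finite {k \<in> {-1 - M..N}. -1 - k + int j \<notin> {-1 - N..M}}"
        by (rule finite_subset[of _ "{-1 - M..N}"]) auto
      show "finite {l \<in> {-1 - N..M}. -1 - l + int j \<notin> {-1 - M..N}}"
        by (rule finite_subset[of _ "{-1 - N..M}"]) auto
    qed simp_all
  qed
  also have "\<dots> = (\<Sum>l = -1 - N..M. \<Sum>j\<le>?J. of_int (ibinom l j) *
          - D (cf Z l * (D ^^ j) (f * cf X (-1 - l + int j))))"
    by (rule sum.swap)
  also have "\<dots> = - D (cf (pmul Z (pmul (fn f) X)) (-1))"
  proof -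
    have D_int: "D (of_int c * x) = of_int c * D x" for c x
      by (simp add: D_mult)
    have J: "nat (M + N - (-1)) = ?J" by (simp add: add.commute)
    show ?thesis
      unfolding cf_pmul[OF NM(2) o2 fin] J pmul_fn_left D_sum D_int
      by (simp add: sum_negf)
  qed
  finally show ?thesis .
qed

end

section \<open>Lambda-brackets as derivations\<close>

locale lambda_bracket =
  test_function D C f fc for D :: "'a::comm_ring_1 \<Rightarrow> 'a" and C f fc +
  fixes lb :: "'a \<Rightarrow> 'a \<Rightarrow> nat \<Rightarrow> 'a"
  assumes lb_closed: "a \<in> C \<Longrightarrow> b \<in> C \<Longrightarrow> lb a b k \<in> C"
    and lb_finite: "a \<in> C \<Longrightarrow> b \<in> C \<Longrightarrow> finite {k. lb a b k \<noteq> 0}"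
    and lb_add: "a \<in> C \<Longrightarrow> b \<in> C \<Longrightarrow> b' \<in> C \<Longrightarrow> lb a (b + b') k = lb a b k + lb a b' k"
    and lb_D: "a \<in> C \<Longrightarrow> b \<in> C \<Longrightarrow>
      lb a (D b) k = D (lb a b k) + (case k of 0 \<Rightarrow> 0 | Suc l \<Rightarrow> lb a b l)"
    and lb_mult: "a \<in> C \<Longrightarrow> b \<in> C \<Longrightarrow> c \<in> C \<Longrightarrow> lb a (b * c) k = lb a b k * c + b * lb a c k"
    and lb_skew: "a \<in> C \<Longrightarrow> b \<in> C \<Longrightarrow> lb b a k = - (\<Sum>l | k \<le> l \<and> lb a b l \<noteq> 0.
        (-1) ^ l * of_nat (l choose k) * (D ^^ (l - k)) (lb a b l))"
begin

text \<open>The form of \<open>{a \<lambda> b}\<close>: the action on \<open>b\<close> of the Hamiltonian vector field of the local functional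
  \<open>\<integral> f a\<close>.\<close>

definition ham :: "'a \<Rightarrow> 'a \<Rightarrow> 'a" where
  "ham a b = (\<Sum>k | lb a b k \<noteq> 0. lb a b k * (D ^^ k) f)"

lemma lb_bound:
  assumes "a \<in> C" "b \<in> C"
  obtains K where "\<And>k. k \<ge> K \<Longrightarrow> lb a b k = 0"
proof -
  obtain K where "{k. lb a b k \<noteq> 0} \<subseteq> {..<K}"
    using finite_nat_bounded[OF lb_finite[OF assms]] by blast
  thus thesis by (intro that[of K]) auto
qed

lemma ham_eq:
  assumes "\<And>k. k \<ge> K \<Longrightarrow> lb a b k = 0"
  shows "ham a b = (\<Sum>k<K. lb a b k * (D ^^ k) f)"
  unfolding ham_def
  by (intro sum.mono_neutral_left) (use assms not_less in auto)

lemma fc_ham: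
  assumes "a \<in> C" "b \<in> C"
  shows "fc k (ham a b) = lb a b k"
  using assms lb_finite[OF assms]
  by (simp add: ham_def fc_sum fc_test lb_closed)

lemma ham_add:
  assumes "a \<in> C" "b \<in> C" "b' \<in> C"
  shows "ham a (b + b') = ham a b + ham a b'"
proof -
  obtain K K' where "\<And>k. k \<ge> K \<Longrightarrow> lb a b k = 0" "\<And>k. k \<ge> K' \<Longrightarrow> lb a b' k = 0"
    using lb_bound[OF assms(1,2)] lb_bound[OF assms(1,3)] by metis
  thus ?thesis
    using assms ham_eq[of "max K K'" a b] ham_eq[of "max K K'" a b']
      ham_eq[of "max K K'" a "b + b'"]
    by (simp add: lb_add distrib_right sum.distrib)
qed

lemma ham_mult:
  assumes "a \<in> C" "b \<in> C" "b' \<in> C"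
  shows "ham a (b * b') = ham a b * b' + b * ham a b'"
proof -
  obtain K K' where "\<And>k. k \<ge> K \<Longrightarrow> lb a b k = 0" "\<And>k. k \<ge> K' \<Longrightarrow> lb a b' k = 0"
    using lb_bound[OF assms(1,2)] lb_bound[OF assms(1,3)] by metis
  thus ?thesis
    using assms ham_eq[of "max K K'" a b] ham_eq[of "max K K'" a b']
      ham_eq[of "max K K'" a "b * b'"]
    by (simp add: lb_mult algebra_simps sum.distrib sum_distrib_left)
qed

text \<open>The operator \<open>\<lambda> + \<partial>\<close> on polynomials in \<open>\<lambda>\<close> corresponds to \<open>D\<close> on forms.\<close>

lemma ham_D:
  assumes "a \<in> C" "b \<in> C"
  shows "ham a (D b) = D (ham a b)"
proof -
  obtain K where K: "\<And>k. k \<ge> K \<Longrightarrow> lb a b k = 0"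
    using lb_bound[OF assms] by metis
  have "lb a (D b) k = 0" if "k \<ge> Suc K" for k
    using that assms K by (cases k) (auto simp: lb_D)
  hence "ham a (D b) = (\<Sum>k<Suc K. lb a (D b) k * (D ^^ k) f)"
    by (rule ham_eq)
  also have "\<dots> = (\<Sum>k<Suc K. D (lb a b k) * (D ^^ k) f)
      + (\<Sum>k<Suc K. (case k of 0 \<Rightarrow> 0 | Suc l \<Rightarrow> lb a b l) * (D ^^ k) f)"
    using assms by (simp only: lb_D distrib_right sum.distrib)
  also have "\<dots> = (\<Sum>k<K. D (lb a b k) * (D ^^ k) f) + (\<Sum>k<K. lb a b k * (D ^^ Suc k) f)"
    using K by (simp add: sum.lessThan_Suc_shift[of _ K, where g = "\<lambda>k. (case k of 0 \<Rightarrow> 0 | Suc l \<Rightarrow> lb a b l) * (D ^^ k) f"] del: sum.lessThan_Suc) simp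
  also have "\<dots> = D (ham a b)"
    by (simp add: ham_eq[OF K] D_sum D_mult sum.distrib)
  finally show ?thesis .
qed

text \<open>In skew-symmetry \<open>\<lambda>\<close> is replaced by \<open>- \<lambda> - \<partial>\<close> acting from the left; on forms this is the formal
  adjoint.\<close>

lemma ham_skew:
  assumes a: "a \<in> C" and b: "b \<in> C"
  shows "ham b a = - Ad (ham a b)"
proof -
  obtain K where K: "\<And>k. k \<ge> K \<Longrightarrow> lb a b k = 0"
    using lb_bound[OF assms] by metis
  let ?c = "\<lambda>l k. (-1) ^ l * of_nat (l choose k) * (D ^^ (l - k)) (lb a b l)"
  have sk: "lb b a k = - (\<Sum>l<K. if k \<le> l then ?c l k else 0)" for k
  proof -
    have "(\<Sum>l | k \<le> l \<and> lb a b l \<noteq> 0. ?c l k) = (\<Sum>l<K. if k \<le> l then ?c l k else 0)"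
      by (rule sum.mono_neutral_cong_left) (use K in \<open>auto simp: not_less[symmetric]\<close>)
    thus ?thesis using lb_skew[OF a b] by simp
  qed
  have K': "lb b a k = 0" if "k \<ge> K" for k
    using that by (auto simp: sk intro: sum.neutral)
  have "ham b a = - (\<Sum>k<K. \<Sum>l<K. (if k \<le> l then ?c l k else 0) * (D ^^ k) f)"
    by (simp add: ham_eq[OF K'] sk sum_distrib_right sum_negf)
  also have "\<dots> = - (\<Sum>l<K. \<Sum>k<K. (if k \<le> l then ?c l k else 0) * (D ^^ k) f)"
    by (subst sum.swap) simp
  also have "\<dots> = - (\<Sum>l<K. (-1) ^ l * (D ^^ l) (lb a b l * f))"
  proof (intro arg_cong[where f = uminus] sum.cong refl)
    fix l assume l: "l \<in> {..<K}"
    have "(\<Sum>k<K. (if k \<le> l then ?c l k else 0) * (D ^^ k) f) = (\<Sum>k\<le>l. ?c l k * (D ^^ k) f)"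
      by (rule sum.mono_neutral_cong_right) (use l in auto)
    also have "\<dots> = (-1) ^ l * (D ^^ l) (lb a b l * f)"
      unfolding Dn_mult by (simp add: sum_distrib_left mult_ac)
    finally show "(\<Sum>k<K. (if k \<le> l then ?c l k else 0) * (D ^^ k) f) = \<dots>" .
  qed
  also have "(\<Sum>l<K. (-1) ^ l * (D ^^ l) (lb a b l * f)) = Ad (ham a b)"
    by (subst Ad_superset[of "{..<K}"]) (use K not_less in \<open>auto simp: fc_ham a b\<close>)
  finally show ?thesis .
qed

lemma derivation_on_ham:
  assumes "a \<in> C"
  shows "derivation_on D C (ham a)"
  by unfold_locales (use assms in \<open>auto simp: C_0 C_add C_minus C_mult C_D ham_add ham_mult ham_D\<close>)

end

section \<open>The bracket of the coefficients of an oper\<close>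

text \<open>The index \<open>N\<close> plays the part of \<open>n + 1\<close>: it is the odd index, where the bracket changes sign and
  where the factor occurs inverted.\<close>

locale oper_bracket =
  lambda_bracket D C f fc lb for D :: "'a::comm_ring_1 \<Rightarrow> 'a" and C f fc lb +
  fixes N :: nat and u :: "nat \<Rightarrow> 'a" and R :: "'a psd"
  assumes N_pos: "1 \<le> N"
    and u_C: "i \<in> {1..N} \<Longrightarrow> u i \<in> C"
    and lb_u: "i \<in> {1..N} \<Longrightarrow> j \<in> {1..N} \<Longrightarrow>
      lb (u i) (u j) k = (if k = 1 \<and> i = j then (if i = N then -1 else 1) else 0)"
    and R_C: "coefs_in C R"
    and R_left: "pmul R (first_order_op (u N)) = pone"
    and R_right: "pmul (first_order_op (u N)) R = pone"
begin

definition prod_ops :: "nat list \<Rightarrow> 'a psd \<Rightarrow> 'a psd" where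
  "prod_ops xs T = foldr pmul (map (\<lambda>i. first_order_op (- u i)) xs) T"

lemma prod_ops_Nil [simp]: "prod_ops [] T = T"
  and prod_ops_Cons: "prod_ops (i # xs) T = pmul (first_order_op (- u i)) (prod_ops xs T)"
  and prod_ops_append: "prod_ops (xs @ ys) T = prod_ops xs (prod_ops ys T)"
  by (simp_all add: prod_ops_def)

lemma prod_ops_pmul: "pmul (prod_ops xs S) T = prod_ops xs (pmul S T)"
  by (induction xs) (simp_all add: prod_ops_Cons psd.mult_assoc)

lemma prod_ops_minus: "prod_ops xs (- T) = - prod_ops xs T"
  by (induction xs) (simp_all add: prod_ops_Cons)

lemma prod_ops_0: "prod_ops xs 0 = 0"
  by (induction xs) (simp_all add: prod_ops_Cons)

definition oper :: "'a psd" where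
  "oper = prod_ops [1..<N] R"

lemma coefs_C_pmul: "coefs_in C S \<Longrightarrow> coefs_in C T \<Longrightarrow> coefs_in C (pmul S T)"
  by (rule coefs_in_pmul) (auto intro: C_0 C_add C_minus C_mult C_Dn)

lemma coefs_C_first_order: "a \<in> C \<Longrightarrow> coefs_in C (first_order_op a)"
  by (simp add: coefs_in_def cf_first_order_op C_0 C_1)

lemma coefs_C_monomial: "a \<in> C \<Longrightarrow> coefs_in C (monomial_op a k)"
  by (simp add: coefs_in_def cf_monomial_op C_0)

lemma coefs_C_prod_ops:
  "set xs \<subseteq> {1..N} \<Longrightarrow> coefs_in C T \<Longrightarrow> coefs_in C (prod_ops xs T)"
  by (induction xs)
    (auto simp: prod_ops_Cons intro!: coefs_C_pmul coefs_C_first_order C_minus u_C)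

lemma oper_C: "coefs_in C oper"
  unfolding oper_def by (rule coefs_C_prod_ops) (auto simp: R_C)

definition ham_op :: "'a \<Rightarrow> 'a psd \<Rightarrow> 'a psd" where
  "ham_op a = derivation_on.ext (ham a)"

context
  fixes a assumes a: "a \<in> C"
begin

interpretation derivation_on D C "ham a"
  by (rule derivation_on_ham[OF a])

lemma cf_ham_op: "cf (ham_op a T) m = ham a (cf T m)"
  by (simp add: ham_op_def cf_ext)

lemma ham_op_pmul:
  "coefs_in C S \<Longrightarrow> coefs_in C T \<Longrightarrow> ham_op a (pmul S T) = pmul (ham_op a S) T + pmul S (ham_op a T)"
  by (simp add: ham_op_def ext_pmul)

lemma ham_1: "ham a 1 = 0"
  using ham_mult[OF a C_1 C_1] by simp

lemma ham_op_first_order: "ham_op a (first_order_op b) = fn (ham a b)"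
  by (rule psd_eqI) (simp add: cf_ham_op cf_first_order_op cf_fn ham_1 \<delta>_0)

lemma ham_op_first_order_minus: "b \<in> C \<Longrightarrow> ham_op a (first_order_op (- b)) = - fn (ham a b)"
  by (simp add: ham_op_first_order \<delta>_minus fn_minus)

text \<open>Apply the derivation to \<open>R Q = 1\<close> with \<open>Q = \<partial> + u\<^sub>N\<close> and multiply by \<open>R\<close> from the right.\<close>

lemma ham_op_R: "ham_op a R = - pmul R (pmul (fn (ham a (u N))) R)"
proof -
  let ?Q = "first_order_op (u N)"
  have Q: "coefs_in C ?Q" using N_pos by (intro coefs_C_first_order u_C) simp
  have "ham_op a pone = 0"
    by (rule psd_eqI) (simp add: cf_ham_op cf_monomial_op ham_1 \<delta>_0)
  hence "pmul (ham_op a R) ?Q + pmul R (fn (ham a (u N))) = 0"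
    using ham_op_pmul[OF R_C Q] by (simp add: R_left ham_op_first_order)
  hence "pmul (ham_op a R) ?Q = - pmul R (fn (ham a (u N)))"
    by (simp add: eq_neg_iff_add_eq_0)
  hence "pmul (pmul (ham_op a R) ?Q) R = pmul (- pmul R (fn (ham a (u N)))) R"
    by simp
  thus ?thesis by (simp add: psd.mult_assoc R_right)
qed

lemma ham_op_prod_ops:
  assumes "set xs \<subseteq> {1..N}" "coefs_in C T" "\<And>j. j \<in> set xs \<Longrightarrow> ham a (u j) = 0"
  shows "ham_op a (prod_ops xs T) = prod_ops xs (ham_op a T)"
  using assms
proof (induction xs)
  case (Cons i xs)
  hence "u i \<in> C" by (auto intro: u_C)
  moreover have "fn 0 = (0 :: 'a psd)" by (rule psd_eqI) (simp add: cf_fn)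
  ultimately show ?case
    using Cons unfolding prod_ops_Cons
    by (subst ham_op_pmul)
      (auto intro!: coefs_C_first_order C_minus coefs_C_prod_ops simp: ham_op_first_order_minus)
qed simp

end

lemma ham_u:
  assumes "i \<in> {1..N}" "j \<in> {1..N}"
  shows "ham (u i) (u j) = (if i = j then (if i = N then - D f else D f) else 0)"
proof -
  have "ham (u i) (u j) = (\<Sum>k<2. lb (u i) (u j) k * (D ^^ k) f)"
    by (rule ham_eq) (use lb_u[OF assms] in auto)
  thus ?thesis using lb_u[OF assms] by (simp add: numeral_2_eq_2)
qed

text \<open>Only the factor that contains \<open>u\<^sub>i\<close> varies. It changes by \<open>- D f\<close>, in accordance with
  \<open>{u\<^sub>i \<lambda> u\<^sub>i} = \<lambda>\<close>.\<close>

lemma ham_op_oper_u: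
  assumes i: "i \<in> {1..<N}"
  shows "ham_op (u i) oper
    = - pmul (prod_ops [1..<i] pone) (pmul (fn (D f)) (prod_ops [Suc i..<N] R))"
proof -
  have u: "u i \<in> C" using i by (intro u_C) auto
  have "[1..<N] = [1..<i] @ i # [Suc i..<N]"
    using i upt_add_eq_append[of 1 i "N - i"] by (simp add: upt_conv_Cons)
  hence L: "oper = prod_ops [1..<i] (pmul (first_order_op (- u i)) (prod_ops [Suc i..<N] R))"
    by (simp only: oper_def prod_ops_append prod_ops_Cons)
  have Y: "coefs_in C (prod_ops [Suc i..<N] R)"
    by (rule coefs_C_prod_ops) (auto simp: R_C)
  have A: "coefs_in C (first_order_op (- u i))"
    using u by (intro coefs_C_first_order C_minus)
  have "fn 0 = (0 :: 'a psd)" by (rule psd_eqI) (simp add: cf_fn)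
  hence "ham_op (u i) R = 0"
    using i by (simp add: ham_op_R[OF u] ham_u)
  hence "ham_op (u i) (prod_ops [Suc i..<N] R) = 0"
    using i by (subst ham_op_prod_ops[OF u]) (auto simp: R_C ham_u prod_ops_0)
  hence "ham_op (u i) (pmul (first_order_op (- u i)) (prod_ops [Suc i..<N] R))
      = - pmul (fn (D f)) (prod_ops [Suc i..<N] R)"
    using i by (simp add: ham_op_pmul[OF u A Y] ham_op_first_order_minus[OF u u] ham_u)
  moreover have "ham_op (u i) oper = prod_ops [1..<i]
      (ham_op (u i) (pmul (first_order_op (- u i)) (prod_ops [Suc i..<N] R)))"
    unfolding L using i
    by (intro ham_op_prod_ops[OF u] coefs_C_pmul A Y) (auto simp: ham_u)
  ultimately show ?thesis
    by (simp add: prod_ops_minus prod_ops_pmul)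
qed

lemma ham_op_oper_u_last:
  "ham_op (u N) oper
    = pmul (pmul (prod_ops [1..<N] pone) R) (pmul (fn (D f)) R)"
proof -
  have u: "u N \<in> C" using N_pos by (intro u_C) auto
  have "ham_op (u N) oper = prod_ops [1..<N] (ham_op (u N) R)"
    unfolding oper_def by (intro ham_op_prod_ops[OF u] R_C) (auto simp: ham_u)
  also have "ham_op (u N) R = pmul R (pmul (fn (D f)) R)"
    using N_pos by (simp add: ham_op_R[OF u] ham_u fn_minus)
  finally show ?thesis by (simp add: prod_ops_pmul)
qed

text \<open>The operator \<open>F = \<partial>^(-m-1) f\<close> is chosen such that the residue of \<open>T F\<close> is \<open>f\<close> times the coefficient
  of \<open>\<partial>^m\<close> in \<open>T\<close>.\<close>

definition test_op :: "int \<Rightarrow> 'a psd" where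
  "test_op m = pmul (monomial_op 1 (-1 - m)) (fn f)"

lemma cf_as_residue: "cf T m = cf (pmul T (monomial_op 1 (-1 - m))) (-1)"
  by (simp add: cf_pmul_D_power)

text \<open>By skew-symmetry this is minus the adjoint of the coefficient of \<open>\<partial>^m\<close> in \<open>{u\<^sub>i \<lambda> L}\<close>. That
  coefficient is a residue with \<open>D f\<close> in the place of the factor \<open>\<partial> - u\<^sub>i\<close>, and \<open>Ad_residue\<close> applies.
  The result is what \<open>adler_first_order\<close> requires of the factor \<open>\<partial> - u\<^sub>i\<close>.\<close>

lemma ham_oper_u:
  assumes i: "i \<in> {1..<N}"
  shows "ham (cf oper m) (u i)
    = - D (cf (pmul (pmul (prod_ops [Suc i..<N] R) (test_op m)) (prod_ops [1..<i] pone)) (-1))"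
proof -
  let ?X = "prod_ops [1..<i] pone" and ?Y = "prod_ops [Suc i..<N] R"
  let ?Z = "pmul ?Y (monomial_op 1 (-1 - m))"
  have u: "u i \<in> C" using i by (intro u_C) auto
  have m: "cf oper m \<in> C" using oper_C by (simp add: coefs_in_def)
  have X: "coefs_in C ?X" and Z: "coefs_in C ?Z"
    using i by (auto intro!: coefs_C_prod_ops coefs_C_pmul coefs_C_monomial C_1 R_C)
  have "ham (cf oper m) (u i) = - Ad (cf (ham_op (u i) oper) m)"
    by (simp add: ham_skew[OF u m] cf_ham_op[OF u])
  also have "cf (ham_op (u i) oper) m = of_int (-1) * cf (pmul ?X (pmul (fn (D f)) ?Z)) (-1)"
    unfolding ham_op_oper_u[OF i] by (subst cf_as_residue) (simp add: psd.mult_assoc)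
  also have "Ad \<dots> = of_int (-1) * Ad (cf (pmul ?X (pmul (fn (D f)) ?Z)) (-1))"
  proof (rule Ad_of_int_mult)
    have "coefs_in (forms C) (pmul ?X (pmul (fn (D f)) ?Z))"
    proof (rule coefs_in_pmul[OF X])
      show "coefs_in (forms C) (pmul (fn (D f)) ?Z)"
        using Z forms_term[of _ C 1]
        by (simp add: coefs_in_def pmul_fn_left mult.commute[of "D f"])
    qed (auto intro: forms_0 forms_add forms_minus C_minus forms_mult forms_Dn C_D C_mult)
    thus "cf (pmul ?X (pmul (fn (D f)) ?Z)) (-1) \<in> forms C" by (simp add: coefs_in_def)
  qed
  also have "Ad (cf (pmul ?X (pmul (fn (D f)) ?Z)) (-1)) = - D (cf (pmul ?Z (pmul (fn f) ?X)) (-1))"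
    by (rule Ad_residue[OF X Z])
  also have "pmul ?Z (pmul (fn f) ?X) = pmul (pmul ?Y (test_op m)) ?X"
    by (simp add: test_op_def psd.mult_assoc)
  finally show ?thesis by simp
qed

text \<open>The computation for the inverted factor. The sign is opposite to that of \<open>ham_oper_u\<close>, as
  \<open>adler_inverse_first_order\<close> requires, because three signs change compared with a factor \<open>\<partial> - u\<^sub>i\<close>:
  the factor contains \<open>+ u\<^sub>N\<close>, it is inverted, and \<open>{u\<^sub>N \<lambda> u\<^sub>N} = - \<lambda>\<close>.\<close>

lemma ham_oper_u_last:
  "ham (cf oper m) (u N)
    = D (cf (pmul R (pmul (test_op m) (pmul (prod_ops [1..<N] pone) R))) (-1))"
proof -
  let ?X = "pmul (prod_ops [1..<N] pone) R"
  let ?Z = "pmul R (monomial_op 1 (-1 - m))"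
  have u: "u N \<in> C" using N_pos by (intro u_C) auto
  have m: "cf oper m \<in> C" using oper_C by (simp add: coefs_in_def)
  have X: "coefs_in C ?X" and Z: "coefs_in C ?Z"
    by (auto intro!: coefs_C_prod_ops coefs_C_pmul coefs_C_monomial C_1 R_C)
  have "ham (cf oper m) (u N) = - Ad (cf (ham_op (u N) oper) m)"
    by (simp add: ham_skew[OF u m] cf_ham_op[OF u])
  also have "cf (ham_op (u N) oper) m = cf (pmul ?X (pmul (fn (D f)) ?Z)) (-1)"
    unfolding ham_op_oper_u_last by (subst cf_as_residue) (simp add: psd.mult_assoc)
  also have "Ad \<dots> = - D (cf (pmul ?Z (pmul (fn f) ?X)) (-1))"
    by (rule Ad_residue[OF X Z])
  also have "pmul ?Z (pmul (fn f) ?X) = pmul R (pmul (test_op m) ?X)"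
    by (simp add: test_op_def psd.mult_assoc)
  finally show ?thesis by simp
qed

text \<open>Build up the product from the right, starting with the inverted factor.\<close>

lemma adler_partial_product:
  assumes "1 \<le> i" "i \<le> N"
  shows "adler (test_op m) (ham_op (cf oper m)) (prod_ops [1..<i] pone) (prod_ops [i..<N] R) pone"
  using assms(2,1)
proof (induction rule: inc_induct)
  case base
  have m: "cf oper m \<in> C" using oper_C by (simp add: coefs_in_def)
  show ?case
    using adler_inverse_first_order[OF R_left R_right] ham_op_R[OF m] ham_oper_u_last[of m]
    by simp
next
  case (step i)
  hence i: "i \<in> {1..<N}" by auto
  have m: "cf oper m \<in> C" using oper_C by (simp add: coefs_in_def)
  have u: "u i \<in> C" using i by (intro u_C) auto
  let ?Y = "prod_ops [Suc i..<N] R" and ?A = "first_order_op (- u i)"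
  have P: "prod_ops [i..<N] R = pmul ?A ?Y"
    using i by (subst upt_conv_Cons) (auto simp: prod_ops_Cons)
  have "prod_ops [1..<Suc i] pone = pmul (prod_ops [1..<i] pone) ?A"
    using i by (simp add: prod_ops_append prod_ops_pmul prod_ops_Cons)
  hence Y: "adler (test_op m) (ham_op (cf oper m)) (pmul (prod_ops [1..<i] pone) ?A) ?Y pone"
    using step by simp
  show ?case
    unfolding P
  proof (rule adler_pmul[OF _ _ Y])
    show "ham_op (cf oper m) (pmul ?A ?Y)
        = pmul (ham_op (cf oper m) ?A) ?Y + pmul ?A (ham_op (cf oper m) ?Y)"
      using i u by (intro ham_op_pmul[OF m] coefs_C_first_order coefs_C_prod_ops R_C C_minus) auto
    have "adler (test_op m) (ham_op (cf oper m)) (prod_ops [1..<i] pone) ?A ?Y"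
      by (rule adler_first_order)
        (simp add: ham_op_first_order_minus[OF m u] ham_oper_u[OF i] fn_minus)
    thus "adler (test_op m) (ham_op (cf oper m)) (prod_ops [1..<i] pone) ?A (pmul ?Y pone)"
      by simp
  qed
qed

lemma ham_op_oper:
  "ham_op (cf oper m) oper
   = pmul oper (ppart (pmul (test_op m) oper)) - pmul (ppart (pmul oper (test_op m))) oper"
  using adler_partial_product[of 1 m] N_pos by (simp add: adler_def oper_def)

text \<open>The forms with coefficients in \<open>B\<close> are a module over \<open>B\<close> that is stable under \<open>D\<close>. So if \<open>L\<close> has
  coefficients in \<open>B\<close>, the operator \<open>L (F L)\<^sub>+ - (L F)\<^sub>+ L\<close> has coefficients among these forms.
  By independence of the \<open>D^k f\<close>, the coefficients of the forms are the brackets.\<close>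

lemma lb_oper_closed:
  assumes B: "B \<subseteq> C" "1 \<in> B" "\<And>x y. x \<in> B \<Longrightarrow> y \<in> B \<Longrightarrow> x + y \<in> B" "\<And>x. x \<in> B \<Longrightarrow> - x \<in> B"
      "\<And>x y. x \<in> B \<Longrightarrow> y \<in> B \<Longrightarrow> x * y \<in> B" "\<And>x. x \<in> B \<Longrightarrow> D x \<in> B"
    and L: "coefs_in B oper"
  shows "lb (cf oper m) (cf oper q) k \<in> B"
proof -
  have B0: "0 \<in> B" using B(3)[OF B(2) B(4)[OF B(2)]] by simp
  have Dn: "x \<in> B \<Longrightarrow> (D ^^ j) x \<in> B" for x j
    by (induction j) (auto intro: B)
  have BT: "coefs_in (forms B) (pmul S T)" if "coefs_in B S" "coefs_in (forms B) T" for S T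
    using that by (rule coefs_in_pmul)
      (auto intro: forms_0 forms_add forms_minus forms_mult forms_Dn B)
  have TB: "coefs_in (forms B) (pmul T S)" if "coefs_in B S" "coefs_in (forms B) T" for S T
    using that(2,1)
  proof (rule coefs_in_pmul)
    show "x * (D ^^ j) y \<in> forms B" if "x \<in> forms B" "y \<in> B" for x y j
      using forms_mult[OF that(1), of "(D ^^ j) y"] B(5)[OF Dn[OF that(2)]]
      by (simp add: mult.commute)
  qed (auto intro: forms_0 forms_add forms_minus B)
  have pp: "coefs_in (forms B) (ppart T)" if "coefs_in (forms B) T" for T
    using that by (auto simp: coefs_in_def cf_ppart forms_0)
  have "coefs_in (forms B) (test_op m)"
    unfolding test_op_def
    by (rule BT) (use forms_term[of 1 B 0] B(2) in \<open>auto simp: coefs_in_def cf_monomial_op cf_fn B0 forms_0\<close>)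
  hence 1: "coefs_in (forms B) (pmul oper (ppart (pmul (test_op m) oper)))"
    and 2: "coefs_in (forms B) (pmul (ppart (pmul oper (test_op m))) oper)"
    by (intro BT TB pp L; assumption)+
  have "coefs_in (forms B) (ham_op (cf oper m) oper)"
    unfolding ham_op_oper coefs_in_def cf_diff
    using forms_add[OF coefs_inD[OF 1] forms_minus[OF coefs_inD[OF 2] B(4)]] by simp
  moreover have C: "cf oper m \<in> C" "cf oper q \<in> C" using oper_C by (simp_all add: coefs_in_def)
  ultimately have "ham (cf oper m) (cf oper q) \<in> forms B"
    by (simp add: coefs_in_def cf_ham_op)
  hence "fc k (ham (cf oper m) (cf oper q)) \<in> B"
    by (rule fc_in[OF B(1) B0, rotated]) (rule B(3))
  thus ?thesis by (simp add: fc_ham C)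
qed

end

section \<open>Inverses of first-order operators\<close>

context derivation
begin

text \<open>The leading coefficient of \<open>Z\<close> survives in the product with a monic operator.\<close>

lemma first_order_left_cancel:
  assumes "pmul (first_order_op a) Z = 0"
  shows "Z = 0"
proof (rule ccontr)
  assume "Z \<noteq> 0"
  then obtain m0 where m0: "cf Z m0 \<noteq> 0" using psd_eqI[of Z 0] by auto
  obtain N where N: "order_le Z N" using order_le_ex by blast
  let ?S = "{m \<in> {m0..N}. cf Z m \<noteq> 0}"
  have "m0 \<in> ?S" using m0 N by (auto intro: leI dest: order_leD)
  moreover have "finite ?S" by (rule finite_subset[of _ "{m0..N}"]) auto
  ultimately have S: "finite ?S" "?S \<noteq> {}" by auto
  define M where "M = Max ?S"
  have M: "cf Z M \<noteq> 0" "m0 \<le> M" using Max_in[OF S] by (auto simp: M_def)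
  have "order_le Z M"
    unfolding order_le_def
  proof (intro allI impI)
    fix m assume m: "m > M"
    show "cf Z m = 0"
    proof (rule ccontr)
      assume "cf Z m \<noteq> 0"
      hence "m \<in> ?S" using m M N by (auto intro: leI dest: order_leD)
      thus False using Max_ge[OF S(1)] m by (fastforce simp: M_def)
    qed
  qed
  hence "cf (pmul (first_order_op a) Z) (1 + M) = cf Z M"
    using cf_pmul_top[OF order_le_first_order_op] by (simp add: cf_first_order_op)
  thus False using assms M by simp
qed

text \<open>The equation \<open>(\<partial> + a) R = 1\<close> determines the coefficients of \<open>R\<close> by a recursion from the top. That
  \<open>R\<close> is also a left inverse follows by cancelling \<open>\<partial> + a\<close> in
  \<open>(\<partial> + a) R (\<partial> + a) = \<partial> + a\<close>.\<close>

lemma first_order_inverse: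
  assumes C: "1 \<in> C" "a \<in> C" "\<And>x y. x \<in> C \<Longrightarrow> y \<in> C \<Longrightarrow> x + y \<in> C" "\<And>x. x \<in> C \<Longrightarrow> - x \<in> C"
    "\<And>x y. x \<in> C \<Longrightarrow> y \<in> C \<Longrightarrow> x * y \<in> C" "\<And>x. x \<in> C \<Longrightarrow> D x \<in> C"
  shows "\<exists>R. coefs_in C R \<and> pmul R (first_order_op a) = pone \<and> pmul (first_order_op a) R = pone
    \<and> order_le R (-1) \<and> cf R (-1) = 1"
proof -
  define r where "r j = ((\<lambda>x. - (D x + a * x)) ^^ j) 1" for j :: nat
  have r_Suc: "r (Suc j) = - (D (r j) + a * r j)" for j
    by (simp add: r_def)
  have r_0: "r 0 = 1" by (simp add: r_def)
  have rC: "r j \<in> C" for j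
    by (induction j) (auto simp: r_0 r_Suc C simp del: minus_add_distrib)
  define R where "R = Psd (\<lambda>m. if m < 0 then r (nat (-1 - m)) else 0)"
  have R: "cf R m = (if m < 0 then r (nat (-1 - m)) else 0)" for m
    unfolding R_def by (subst Psd_inverse) (auto intro: exI[of _ 0])
  have "0 \<in> C" using C(3)[OF C(1) C(4)[OF C(1)]] by simp
  hence RC: "coefs_in C R" by (simp add: coefs_in_def R rC)
  have QR: "pmul (first_order_op a) R = pone"
  proof (rule psd_eqI)
    fix m
    have "m < 0 \<Longrightarrow> nat (- m) = Suc (nat (-1 - m))" by simp
    moreover have "cf (pmul (first_order_op a) R) m = cf R (m - 1) + D (cf R m) + a * cf R m"
      by (simp add: first_order_op_def psd.distrib_right cf_pmul_D_left pmul_fn_left)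
    ultimately show "cf (pmul (first_order_op a) R) m = cf pone m"
      by (auto simp: R cf_monomial_op r_Suc r_0)
  qed
  have "pmul (first_order_op a) (pmul R (first_order_op a) - pone) = 0"
    using QR by (simp add: psd.right_diff_distrib psd.mult_assoc[symmetric])
  hence "pmul R (first_order_op a) = pone"
    using first_order_left_cancel by fastforce
  thus ?thesis using RC QR by (intro exI[of _ R]) (auto simp: R r_0 order_le_def)
qed

end

context oper_bracket
begin

lemma prod_ops_monic:
  assumes "order_le R (-1)" "cf R (-1) = 1"
  shows "order_le (prod_ops xs R) (int (length xs) - 1) \<and> cf (prod_ops xs R) (int (length xs) - 1) = 1"
proof (induction xs)
  case (Cons i xs)
  thus ?case
    using order_le_pmul[OF order_le_first_order_op[of "- u i"], of "prod_ops xs R" "int (length xs) - 1"]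
      cf_pmul_top[OF order_le_first_order_op[of "- u i"], of "prod_ops xs R" "int (length xs) - 1"]
    by (simp add: prod_ops_Cons cf_first_order_op)
qed (simp add: assms)

end

section \<open>Differential polynomials\<close>

lemma lin_scale_eq: "lin_scale c f = Poly_Mapping.single 0 c * f" for f :: dpoly
  by (simp add: lin_scale_def mult_map_scale_conv_mult)

lemma lin_scale_of_int: "lin_scale (of_int z) f = of_int z * f" for f :: dpoly
  by (simp add: lin_scale_eq)

lemma lin_scale_minus1: "lin_scale (-1) f = - f" for f :: dpoly
  using lin_scale_of_int[of "-1" f] by simp

text \<open>The derivative of a monomial. The derivation is linear, so that its Leibniz rule reduces to
  monomials, where it is the additivity of exponents.\<close>

definition der_mon :: "((nat \<times> nat) \<Rightarrow>\<^sub>0 nat) \<Rightarrow> dpoly" where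
  "der_mon m = (\<Sum>(i, r)\<in>Poly_Mapping.keys m. Poly_Mapping.single
       (m - Poly_Mapping.single (i, r) 1 + Poly_Mapping.single (i, Suc r) 1)
       (of_nat (Poly_Mapping.lookup m (i, r))))"

lemma der_mon_superset:
  assumes "finite K" "Poly_Mapping.keys m \<subseteq> K"
  shows "der_mon m = (\<Sum>(i, r)\<in>K. Poly_Mapping.single
       (m - Poly_Mapping.single (i, r) 1 + Poly_Mapping.single (i, Suc r) 1)
       (of_nat (Poly_Mapping.lookup m (i, r))))"
  unfolding der_mon_def
  by (rule sum.mono_neutral_left) (use assms in \<open>auto simp: in_keys_iff\<close>)

lemma dpoly_der_superset:
  assumes "finite K" "Poly_Mapping.keys f \<subseteq> K"
  shows "dpoly_der f = (\<Sum>m\<in>K. Poly_Mapping.single 0 (Poly_Mapping.lookup f m) * der_mon m)"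
proof -
  have "dpoly_der f = (\<Sum>m\<in>Poly_Mapping.keys f. Poly_Mapping.single 0 (Poly_Mapping.lookup f m) * der_mon m)"
    unfolding dpoly_der_def der_mon_def
    by (intro sum.cong refl) (simp add: sum_distrib_left mult_single split_def mult.commute)
  also have "\<dots> = (\<Sum>m\<in>K. Poly_Mapping.single 0 (Poly_Mapping.lookup f m) * der_mon m)"
    by (rule sum.mono_neutral_left) (use assms in \<open>auto simp: in_keys_iff\<close>)
  finally show ?thesis .
qed

lemma dpoly_der_single: "dpoly_der (Poly_Mapping.single m c) = Poly_Mapping.single 0 c * der_mon m"
  by (subst dpoly_der_superset[of "{m}"]) auto

lemma dpoly_der_add: "dpoly_der (f + g) = dpoly_der f + dpoly_der g"
proof -
  let ?K = "Poly_Mapping.keys f \<union> Poly_Mapping.keys g"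
  have 1: "Poly_Mapping.keys (f + g) \<subseteq> ?K" by (rule Poly_Mapping.keys_add)
  show ?thesis
    by (subst (1 2 3) dpoly_der_superset[of ?K])
      (use 1 in \<open>auto simp: lookup_add single_add distrib_right sum.distrib\<close>)
qed

lemma dpoly_der_sum: "dpoly_der (sum g I) = (\<Sum>i\<in>I. dpoly_der (g i))"
proof (induction I rule: infinite_finite_induct)
  have "dpoly_der 0 = 0" by (simp add: dpoly_der_def)
  thus "dpoly_der (sum g {}) = (\<Sum>i\<in>{}. dpoly_der (g i))"
    "infinite I \<Longrightarrow> dpoly_der (sum g I) = (\<Sum>i\<in>I. dpoly_der (g i))" for I by simp_all
qed (simp add: dpoly_der_add)

lemma dpoly_sum_singles:
  "f = (\<Sum>m\<in>Poly_Mapping.keys f. Poly_Mapping.single m (Poly_Mapping.lookup f m))" for f :: dpoly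
  by (rule poly_mapping_eqI) (simp add: lookup_sum lookup_single when_def in_keys_iff)

lemma der_mon_half:
  assumes "finite K" "Poly_Mapping.keys m \<subseteq> K"
  shows "der_mon m * Poly_Mapping.single m' 1 = (\<Sum>(i, r)\<in>K. Poly_Mapping.single
       (m + m' - Poly_Mapping.single (i, r) 1 + Poly_Mapping.single (i, Suc r) 1)
       (of_nat (Poly_Mapping.lookup m (i, r))))"
  unfolding der_mon_superset[OF assms] sum_distrib_right
proof (intro sum.cong refl, safe)
  fix i r :: nat
  let ?e = "Poly_Mapping.single (i, r) (1 :: nat)" and ?e' = "Poly_Mapping.single (i, Suc r) (1 :: nat)"
  show "Poly_Mapping.single (m - ?e + ?e') (of_nat (Poly_Mapping.lookup m (i, r))) * Poly_Mapping.single m' 1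
    = (Poly_Mapping.single (m + m' - ?e + ?e') (of_nat (Poly_Mapping.lookup m (i, r))) :: dpoly)"
  proof (cases "Poly_Mapping.lookup m (i, r) = 0")
    case False
    hence "m - ?e + ?e' + m' = m + m' - ?e + ?e'"
      by (intro poly_mapping_eqI) (auto simp: lookup_add lookup_minus lookup_single when_def)
    thus ?thesis by (simp add: mult_single)
  qed simp
qed

lemma der_mon_add:
  "der_mon (m + m') = der_mon m * Poly_Mapping.single m' 1 + Poly_Mapping.single m 1 * der_mon m'"
proof -
  let ?K = "Poly_Mapping.keys m \<union> Poly_Mapping.keys m'"
  have K: "finite ?K" "Poly_Mapping.keys m \<subseteq> ?K" "Poly_Mapping.keys m' \<subseteq> ?K"
    "Poly_Mapping.keys (m + m') \<subseteq> ?K"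
    by (auto dest: subsetD[OF Poly_Mapping.keys_add])
  show ?thesis
    unfolding mult.commute[of "Poly_Mapping.single m 1"] der_mon_half[OF K(1,2)] der_mon_half[OF K(1,3)]
      der_mon_superset[OF K(1,4)] sum.distrib[symmetric]
    by (intro sum.cong refl) (auto simp: lookup_add single_add add.commute)
qed

lemma dpoly_der_mult: "dpoly_der (f * g) = dpoly_der f * g + f * dpoly_der g"
proof -
  let ?s = "\<lambda>f m. Poly_Mapping.single m (Poly_Mapping.lookup f m) :: dpoly"
  have s: "dpoly_der (?s f m * ?s g m') = dpoly_der (?s f m) * ?s g m' + ?s f m * dpoly_der (?s g m')"
    for m m'
  proof -
    let ?a = "Poly_Mapping.lookup f m" and ?b = "Poly_Mapping.lookup g m'"
    have 1: "Poly_Mapping.single m c = Poly_Mapping.single 0 c * Poly_Mapping.single m (1 :: complex)" for m :: "(nat \<times> nat) \<Rightarrow>\<^sub>0 nat" and c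
      by (simp add: mult_single)
    have "dpoly_der (?s f m * ?s g m')
        = Poly_Mapping.single 0 ?a * Poly_Mapping.single 0 ?b * der_mon (m + m')"
      by (simp add: mult_single dpoly_der_single)
    also have "\<dots> = Poly_Mapping.single 0 ?a * der_mon m * (Poly_Mapping.single 0 ?b * Poly_Mapping.single m' 1)
        + (Poly_Mapping.single 0 ?a * Poly_Mapping.single m 1) * (Poly_Mapping.single 0 ?b * der_mon m')"
      unfolding der_mon_add by (simp only: algebra_simps)
    also have "\<dots> = dpoly_der (?s f m) * ?s g m' + ?s f m * dpoly_der (?s g m')"
      unfolding dpoly_der_single using 1[of m ?a] 1[of m' ?b] by simp
    finally show ?thesis .
  qed
  have "dpoly_der ((\<Sum>m\<in>Poly_Mapping.keys f. ?s f m) * (\<Sum>m\<in>Poly_Mapping.keys g. ?s g m))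
      = dpoly_der (\<Sum>m\<in>Poly_Mapping.keys f. ?s f m) * (\<Sum>m\<in>Poly_Mapping.keys g. ?s g m)
      + (\<Sum>m\<in>Poly_Mapping.keys f. ?s f m) * dpoly_der (\<Sum>m\<in>Poly_Mapping.keys g. ?s g m)"
    unfolding sum_product dpoly_der_sum by (simp add: s sum.distrib)
  thus ?thesis by (simp only: dpoly_sum_singles[symmetric])
qed

interpretation dpoly: derivation dpoly_der
  by standard (rule dpoly_der_add dpoly_der_mult)+

lemma dpoly_der_uvar: "dpoly_der (uvar i r) = uvar i (Suc r)"
  by (simp add: uvar_def dpoly_der_single der_mon_def)

lemma dpoly_der_funpow_uvar: "(dpoly_der ^^ k) (uvar i 0) = uvar i k"
  by (induction k) (simp_all add: dpoly_der_uvar)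

text \<open>The variables \<open>\<partial>^k u\<^sub>0\<close> do not occur in the carrier of \<open>pi0 n\<close>, so \<open>u\<^sub>0\<close> serves as the test
  function. The functional \<open>fcoef k\<close> removes one factor \<open>\<partial>^k u\<^sub>0\<close> from each monomial
  that contains it and drops the other monomials.\<close>

definition fcoef :: "nat \<Rightarrow> dpoly \<Rightarrow> dpoly" where
  "fcoef k = Poly_Mapping.map_key (\<lambda>m. m + Poly_Mapping.single (0, k) 1)"

lemma inj_shift: "inj (\<lambda>m. m + Poly_Mapping.single (0, k) 1 :: (nat \<times> nat) \<Rightarrow>\<^sub>0 nat)"
  by (auto simp: inj_on_def)

lemma fcoef_add: "fcoef k (x + y) = fcoef k x + fcoef k y"
  unfolding fcoef_def by (rule map_key_plus[OF inj_shift])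

lemma lookup_fcoef:
  "Poly_Mapping.lookup (fcoef k x) m = Poly_Mapping.lookup x (m + Poly_Mapping.single (0, k) 1)"
  unfolding fcoef_def map_key.rep_eq[OF inj_shift] by simp

lemma fcoef_sum: "fcoef k (sum g I) = (\<Sum>i\<in>I. fcoef k (g i))"
proof (induction I rule: infinite_finite_induct)
  have "fcoef k 0 = 0" using fcoef_add[of k 0 0] by simp
  thus "fcoef k (sum g {}) = (\<Sum>i\<in>{}. fcoef k (g i))"
    "infinite I \<Longrightarrow> fcoef k (sum g I) = (\<Sum>i\<in>I. fcoef k (g i))" for I by simp_all
qed (simp add: fcoef_add)

lemma fcoef_test:
  assumes c: "c \<in> carr (pi0 n)"
  shows "fcoef k (c * (dpoly_der ^^ l) (uvar 0 0)) = (if k = l then c else 0)"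
proof -
  let ?s = "\<lambda>m. Poly_Mapping.single m (Poly_Mapping.lookup c m) :: dpoly"
  have s: "fcoef k (?s m * uvar 0 l) = (if k = l then ?s m else 0)" if m: "m \<in> Poly_Mapping.keys c" for m
  proof (rule poly_mapping_eqI)
    fix m0
    have "(0, k) \<notin> Poly_Mapping.keys m"
      using c m by (force simp: pi0_def)
    hence "Poly_Mapping.lookup m (0, k) = 0" by (simp add: in_keys_iff)
    hence "k \<noteq> l \<Longrightarrow> m + Poly_Mapping.single (0, l) 1 \<noteq> m0 + Poly_Mapping.single (0, k) 1"
      by (auto dest!: arg_cong[where f = "\<lambda>p. Poly_Mapping.lookup p (0, k)"]
          simp: lookup_add lookup_single when_def)
    thus "Poly_Mapping.lookup (fcoef k (?s m * uvar 0 l)) m0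
        = Poly_Mapping.lookup (if k = l then ?s m else 0) m0"
      by (auto simp: lookup_fcoef uvar_def mult_single lookup_single when_def)
  qed
  have "fcoef k ((\<Sum>m\<in>Poly_Mapping.keys c. ?s m) * uvar 0 l) = (if k = l then (\<Sum>m\<in>Poly_Mapping.keys c. ?s m) else 0)"
    by (simp add: sum_distrib_right fcoef_sum s)
  thus ?thesis by (simp only: dpoly_sum_singles[symmetric] dpoly_der_funpow_uvar)
qed

lemma uvar_carr: "i \<in> {1..n + 1} \<Longrightarrow> uvar i 0 \<in> carr (pi0 n)"
  by (simp add: uvar_def pi0_def)

lemma psmul_cf: "psmul (cf A) (cf B) = cf (dpoly.pmul A B)"
proof
  fix m
  have "lin_scale (of_int k gchoose j) x = of_int (ibinom k j) * x" for k j and x :: dpoly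
    by (simp add: of_int_ibinom[symmetric] lin_scale_of_int)
  thus "psmul (cf A) (cf B) m = cf (dpoly.pmul A B) m"
    by (simp add: psmul_def dpoly.cf_pmul_support dpoly.pterm_def)
qed

lemma first_order_cf: "first_order a = cf (first_order_op a)"
  by (rule ext) (simp add: first_order_def cf_first_order_op)

lemma psone_cf: "psone = cf dpoly.pone"
  by (rule ext) (simp add: psone_def cf_monomial_op)

lemma psdos_cf: "A \<in> psdos n \<longleftrightarrow> (\<exists>A'. A = cf A' \<and> coefs_in (carr (pi0 n)) A')"
proof
  assume "A \<in> psdos n"
  hence "A = cf (Psd A)" "\<forall>m. A m \<in> carr (pi0 n)" by (auto simp: psdos_def Psd_inverse)
  thus "\<exists>A'. A = cf A' \<and> coefs_in (carr (pi0 n)) A'"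
    by (metis coefs_in_def)
qed (use cf in \<open>auto simp: psdos_def coefs_in_def\<close>)

text \<open>Two-sided inverses are unique, so the definite description denotes any inverse that is exhibited.\<close>

lemma psinv_cf:
  assumes R: "coefs_in (carr (pi0 n)) R" and l: "dpoly.pmul R A = dpoly.pone"
    and r: "dpoly.pmul A R = dpoly.pone"
  shows "psinv n (cf A) = cf R"
  unfolding psinv_def
proof (rule the_equality)
  show "cf R \<in> psdos n \<and> psmul (cf A) (cf R) = psone \<and> psmul (cf R) (cf A) = psone"
    using assms by (auto simp: psdos_cf psmul_cf psone_cf)
next
  fix B assume B: "B \<in> psdos n \<and> psmul (cf A) B = psone \<and> psmul B (cf A) = psone"
  then obtain B' where B': "B = cf B'" by (auto simp: psdos_cf)
  hence "dpoly.pmul A B' = dpoly.pone" using B by (simp add: psmul_cf psone_cf cf_inject)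
  hence "dpoly.pmul (dpoly.pmul R A) B' = R" by (simp add: dpoly.psd.mult_assoc)
  thus "B = cf R" by (simp add: l B')
qed

section \<open>Poisson vertex subalgebras\<close>

context differential_algebra
begin

lemma scl_0: "a \<in> carr A \<Longrightarrow> scl A 0 a = 0"
  using scl_add_left[of a 0 0] by simp

lemma scl_minus_1: "a \<in> carr A \<Longrightarrow> scl A (-1) a = - a"
  using scl_add_left[of a 1 "-1"] by (simp add: scl_0 scl_one eq_neg_iff_add_eq_0 add.commute)

lemma minus_closed: "a \<in> carr A \<Longrightarrow> - a \<in> carr A"
  using scl_closed[of a "-1"] by (simp add: scl_minus_1)

lemma sum_closed: "(\<And>i. i \<in> I \<Longrightarrow> g i \<in> carr A) \<Longrightarrow> sum g I \<in> carr A"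
  by (induction I rule: infinite_finite_induct) (auto intro: zero_closed add_closed)

lemma der_funpow_closed: "a \<in> carr A \<Longrightarrow> (der A ^^ k) a \<in> carr A"
  by (induction k) (auto intro: der_closed)

end

lemma differential_algebra_restrict:
  assumes "differential_algebra A" and B: "differential_subalgebra A B"
  shows "differential_algebra (A\<lparr>carr := B\<rparr>)"
proof -
  interpret differential_algebra A by fact
  have sub: "a \<in> carr A" if "a \<in> B" for a
    using B that by (auto simp: differential_subalgebra_def)
  show ?thesis
  proof
    fix a b assume "a \<in> carr (A\<lparr>carr := B\<rparr>)" "b \<in> carr (A\<lparr>carr := B\<rparr>)"
    thus "mul (A\<lparr>carr := B\<rparr>) a b = mul (A\<lparr>carr := B\<rparr>) b a"
      using mul_comm[of a b] sub by simp
  qed (use B in \<open>simp_all add: differential_subalgebra_def sub scl_add_right scl_add_left scl_scl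
      scl_one mul_assoc mul_unt mul_add mul_scl der_add der_scl der_mul\<close>)
qed

lemma poisson_vertex_algebra_restrict:
  assumes "poisson_vertex_subalgebra A lb B"
  shows "poisson_vertex_algebra (A\<lparr>carr := B\<rparr>) lb"
proof -
  interpret poisson_vertex_algebra A lb
    using assms by (simp add: poisson_vertex_subalgebra_def)
  have B: "differential_subalgebra A B" and lbB: "\<forall>a\<in>B. \<forall>b\<in>B. \<forall>k. lb a b k \<in> B"
    using assms by (auto simp: poisson_vertex_subalgebra_def)
  have sub: "a \<in> carr A" if "a \<in> B" for a
    using B that by (auto simp: differential_subalgebra_def)
  interpret B: differential_algebra "A\<lparr>carr := B\<rparr>"
    by (rule differential_algebra_restrict) (rule differential_algebra_axioms B)+
  show ?thesis
  proof
    fix a b k assume "a \<in> carr (A\<lparr>carr := B\<rparr>)" "b \<in> carr (A\<lparr>carr := B\<rparr>)"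
    thus "lb b a k = - (\<Sum>l | k \<le> l \<and> lb a b l \<noteq> 0.
        scl (A\<lparr>carr := B\<rparr>) ((-1) ^ l * of_nat (l choose k))
          ((der (A\<lparr>carr := B\<rparr>) ^^ (l - k)) (lb a b l)))"
      using lb_skew[of a b k] sub by simp
  qed (use lbB in \<open>simp_all add: sub lb_finite lb_add_left lb_add_right lb_scl_left lb_scl_right
      lb_der_left lb_der_right lb_jacobi lb_leibniz\<close>)
qed

text \<open>The test function is \<open>u\<^sub>0\<close>. The factors \<open>(-1)^l (l choose k)\<close> of skew-symmetry, which are scalars on one
  side, are integers on the other.\<close>

lemma oper_bracket_pi0:
  assumes "standard_pva n lb"
  shows "\<exists>R. oper_bracket dpoly_der (carr (pi0 n)) (uvar 0 0) fcoef lb (n + 1) (\<lambda>i. uvar i 0) R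
    \<and> order_le R (-1) \<and> cf R (-1) = 1"
proof -
  interpret P: poisson_vertex_algebra "pi0 n" lb
    using assms by (simp add: standard_pva_def)
  have sel [simp]: "scl (pi0 n) = lin_scale" "mul (pi0 n) = (*)" "unt (pi0 n) = 1" "der (pi0 n) = dpoly_der"
    by (simp_all add: pi0_def)
  note cl = P.zero_closed P.add_closed P.minus_closed P.mul_closed[simplified]
    P.unt_closed[simplified] P.der_closed[simplified]
  obtain R where R: "coefs_in (carr (pi0 n)) R"
    "dpoly.pmul R (first_order_op (uvar (n + 1) 0)) = dpoly.pone"
    "dpoly.pmul (first_order_op (uvar (n + 1) 0)) R = dpoly.pone"
    "order_le R (-1)" "cf R (-1) = 1"
    using dpoly.first_order_inverse[of "carr (pi0 n)" "uvar (n + 1) 0"] cl uvar_carr[of "n + 1" n]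
    by auto
  have scale: "lin_scale ((-1) ^ l * of_nat c) x = (-1) ^ l * of_nat c * x" for l c and x :: dpoly
    using lin_scale_of_int[of "(-1) ^ l * int c" x] by simp
  have "oper_bracket dpoly_der (carr (pi0 n)) (uvar 0 0) fcoef lb (n + 1) (\<lambda>i. uvar i 0) R"
  proof unfold_locales
    fix a b k assume ab: "a \<in> carr (pi0 n)" "b \<in> carr (pi0 n)"
    show "lb b a k = - (\<Sum>l | k \<le> l \<and> lb a b l \<noteq> 0.
        (-1) ^ l * of_nat (l choose k) * (dpoly_der ^^ (l - k)) (lb a b l))"
      using P.lb_skew[OF ab, of k] by (simp add: scale)
  next
    fix i j k assume "i \<in> {1..n + 1}" "j \<in> {1..n + 1}"
    hence "lb (uvar i 0) (uvar j 0) k = (if k = 1 then lin_scale (kappa_V n i j) 1 else 0)"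
      using assms by (auto simp: standard_pva_def)
    thus "lb (uvar i 0) (uvar j 0) k
        = (if k = 1 \<and> i = j then (if i = n + 1 then - 1 else 1) else 0)"
      using lin_scale_of_int[of 1 1] lin_scale_of_int[of 0 1]
      by (auto simp: kappa_V_def psign_def odd_index_def lin_scale_minus1)
  qed (use R in \<open>auto simp: cl fcoef_add fcoef_test uvar_carr P.lb_closed P.lb_finite P.lb_add_right
      P.lb_der_right[simplified] P.lb_leibniz[simplified]\<close>)
  thus ?thesis using R by blast
qed

lemma differential_subalgebra_generated:
  assumes "differential_algebra A" "S \<subseteq> carr A"
  shows "differential_subalgebra A (differential_subalgebra_generated A S)"
    and "S \<subseteq> differential_subalgebra_generated A S"
proof -
  interpret differential_algebra A by fact
  have "differential_subalgebra A (carr A)"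
    by (simp add: differential_subalgebra_def zero_closed add_closed mul_closed unt_closed
        der_closed scl_closed)
  hence "differential_subalgebra_generated A S \<subseteq> carr A"
    using assms(2) by (auto simp: differential_subalgebra_generated_def)
  thus "differential_subalgebra A (differential_subalgebra_generated A S)"
    unfolding differential_subalgebra_def[of A "differential_subalgebra_generated A S"]
    by (auto simp: differential_subalgebra_generated_def differential_subalgebra_def)
  show "S \<subseteq> differential_subalgebra_generated A S"
    by (auto simp: differential_subalgebra_generated_def)
qed

lemma differential_subalgebra_generated_induct:
  assumes "x \<in> differential_subalgebra_generated A S" "differential_subalgebra A B" "S \<subseteq> B"
  shows "x \<in> B"
  using assms by (auto simp: differential_subalgebra_generated_def)

text \<open>For fixed \<open>a\<close>, the elements \<open>b\<close> of the subalgebra with \<open>{a \<lambda> b}\<close> in the subalgebra form a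
  differential subalgebra, by sesquilinearity and the Leibniz rule in the second argument. This extends
  the closure from generators to all \<open>b\<close>; skew-symmetry exchanges the arguments, and the same argument
  applies once more.\<close>

lemma (in poisson_vertex_algebra) poisson_vertex_subalgebra_generated:
  assumes S: "S \<subseteq> carr A"
    and gen: "\<And>a b k. a \<in> S \<Longrightarrow> b \<in> S \<Longrightarrow> lb a b k \<in> differential_subalgebra_generated A S"
  shows "poisson_vertex_subalgebra A lb (differential_subalgebra_generated A S)"
proof -
  define B where "B = differential_subalgebra_generated A S"
  have B: "differential_subalgebra A B" and SB: "S \<subseteq> B"
    unfolding B_def using differential_subalgebra_generated[OF differential_algebra_axioms S] by auto
  have sub: "x \<in> carr A" if "x \<in> B" for x
    using B that by (auto simp: differential_subalgebra_def)
  interpret B: differential_algebra "A\<lparr>carr := B\<rparr>"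
    by (rule differential_algebra_restrict) (rule differential_algebra_axioms B)+
  have right: "lb a b k \<in> B"
    if a: "a \<in> carr A" and gens: "\<And>b k. b \<in> S \<Longrightarrow> lb a b k \<in> B" and b: "b \<in> B" for a b k
  proof -
    let ?T = "{b \<in> B. \<forall>k. lb a b k \<in> B}"
    have lb0: "lb a 0 k = 0" for k
      using lb_add_right[OF a zero_closed zero_closed, of k] by simp
    have lb1: "lb a (unt A) k = 0" for k
    proof -
      have "mul A (lb a (unt A) k) (unt A) = lb a (unt A) k"
        by (subst mul_comm) (simp_all add: mul_unt lb_closed a unt_closed)
      thus ?thesis
        using lb_leibniz[OF a unt_closed unt_closed, of k]
        by (simp add: mul_unt lb_closed a unt_closed)
    qed
    have "differential_subalgebra A ?T"
      unfolding differential_subalgebra_def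
    proof (intro conjI ballI allI)
      fix b c s assume bc: "b \<in> ?T" "c \<in> ?T"
      hence bcA: "b \<in> carr A" "c \<in> carr A" by (auto intro: sub)
      show "b + c \<in> ?T"
        using B.add_closed bc by (auto simp: lb_add_right[OF a bcA])
      show "mul A b c \<in> ?T"
        using B.mul_closed B.add_closed bc by (auto simp: lb_leibniz[OF a bcA])
      show "der A b \<in> ?T"
        using B.der_closed B.add_closed B.zero_closed bc
        by (auto simp: lb_der_right[OF a bcA(1)] split: nat.splits)
      show "scl A s b \<in> ?T"
        using B.scl_closed bc by (auto simp: lb_scl_right[OF a bcA(1)])
    qed (use B.zero_closed B.unt_closed in \<open>auto intro: sub simp: lb0 lb1\<close>)
    moreover have "S \<subseteq> ?T" using SB gens by auto
    ultimately have "b \<in> ?T"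
      using b differential_subalgebra_generated_induct unfolding B_def by blast
    thus ?thesis by simp
  qed
  have skew: "lb b a k \<in> B" if a: "a \<in> carr A" "b \<in> carr A" and ab: "\<And>l. lb a b l \<in> B" for a b k
  proof -
    let ?t = "\<lambda>l. scl A ((-1) ^ l * of_nat (l choose k)) ((der A ^^ (l - k)) (lb a b l))"
    have "?t l \<in> B" for l
      using B.scl_closed[of "(der A ^^ (l - k)) (lb a b l)"] B.der_funpow_closed[of "lb a b l" "l - k"] ab[of l]
      by simp
    hence "(\<Sum>l | k \<le> l \<and> lb a b l \<noteq> 0. ?t l) \<in> B"
      using B.sum_closed[of "{l. k \<le> l \<and> lb a b l \<noteq> 0}" ?t] by simp
    hence "- (\<Sum>l | k \<le> l \<and> lb a b l \<noteq> 0. ?t l) \<in> B"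
      using B.minus_closed by simp
    thus ?thesis
      by (simp only: lb_skew[OF a])
  qed
  have "lb a b k \<in> B" if a: "a \<in> B" and b: "b \<in> B" for a b k
  proof (rule right[OF sub[OF a] _ b])
    fix c k assume c: "c \<in> S"
    have "lb c a l \<in> B" for l
      by (rule right[OF _ _ a]) (use c S gen in \<open>auto simp: B_def\<close>)
    thus "lb a c k \<in> B"
      using skew[of c a k] c S sub[OF a] by auto
  qed
  thus ?thesis
    unfolding poisson_vertex_subalgebra_def B_def[symmetric]
    using B poisson_vertex_algebra_axioms by auto
qed

text \<open>The coefficients of \<open>L\<close> are the generators \<open>W\<^sub>p\<close> together with the constants \<open>1\<close>, at \<open>\<partial>^(n-1)\<close>, and
  \<open>0\<close>, above it; so \<open>L\<close> has coefficients in the algebra that its coefficients generate.\<close>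

lemma FunOp_poisson_vertex_subalgebra:
  assumes "standard_pva n lb"
  shows "poisson_vertex_subalgebra (pi0 n) lb (FunOp n)"
proof -
  interpret P: poisson_vertex_algebra "pi0 n" lb
    using assms by (simp add: standard_pva_def)
  obtain R where R: "oper_bracket dpoly_der (carr (pi0 n)) (uvar 0 0) fcoef lb (n + 1) (\<lambda>i. uvar i 0) R"
    "order_le R (-1)" "cf R (-1) = 1"
    using oper_bracket_pi0[OF assms] by blast
  interpret O: oper_bracket dpoly_der "carr (pi0 n)" "uvar 0 0" fcoef lb "n + 1" "\<lambda>i. uvar i 0" R
    by (rule R)
  have prod: "foldr psmul (map (\<lambda>i. first_order (- uvar i 0)) xs) (cf T) = cf (O.prod_ops xs T)" for xs T
    by (induction xs) (simp_all add: O.prod_ops_Cons first_order_cf psmul_cf)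
  have L: "oper_L n = cf O.oper"
    unfolding oper_L_def first_order_cf[of "uvar (n + 1) 0"] psinv_cf[OF O.R_C O.R_left O.R_right] prod O.oper_def ..
  have top: "order_le O.oper (int n - 1)" "cf O.oper (int n - 1) = 1"
    unfolding O.oper_def
    using O.prod_ops_monic[OF R(2,3), of "[1..<n + 1]"] by (simp_all del: upt_Suc)
  let ?S = "{W_coeff n p | p. p \<ge> 1}"
  have W: "W_coeff n p = cf O.oper (int n - 1 - int p)" for p
    by (simp add: W_coeff_def L)
  have S: "?S \<subseteq> carr (pi0 n)"
    using O.oper_C by (auto simp: W coefs_in_def)
  have B: "differential_subalgebra (pi0 n) (FunOp n)" and SB: "?S \<subseteq> FunOp n"
    unfolding FunOp_def
    using differential_subalgebra_generated[OF P.differential_algebra_axioms S] by auto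
  have "coefs_in (FunOp n) O.oper"
    unfolding coefs_in_def
  proof
    fix m
    consider "m > int n - 1" | "m = int n - 1" | "m < int n - 1" by linarith
    thus "cf O.oper m \<in> FunOp n"
    proof cases
      case 3
      hence "cf O.oper m = W_coeff n (nat (int n - 1 - m))" by (simp add: W)
      thus ?thesis using 3 SB by fastforce
    qed (use B top in \<open>auto simp: differential_subalgebra_def order_le_def pi0_def\<close>)
  qed
  hence "lb (cf O.oper m) (cf O.oper q) k \<in> FunOp n" for m q k
    by (rule O.lb_oper_closed[rotated -1])
      (use B in \<open>auto simp: differential_subalgebra_def pi0_def lin_scale_minus1[symmetric]\<close>)
  thus ?thesis
    unfolding FunOp_def using S
    by (intro P.poisson_vertex_subalgebra_generated) (auto simp: W FunOp_def)
qed

section \<open>Transport of structure\<close>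

text \<open>Each axiom holds after applying the injective homomorphism \<open>h\<close>. That \<open>Z\<close> is closed under its
  operations has to be supposed, since \<open>h\<close> is only known to be compatible with them.\<close>

lemma poisson_vertex_algebra_pullback:
  fixes Z :: "'v::ab_group_add diffalg" and A :: "'a::ab_group_add diffalg"
  assumes A: "poisson_vertex_algebra A lb" and iso: "diffalg_iso h Z A"
    and Z: "0 \<in> carr Z" "unt Z \<in> carr Z"
      "\<And>a b. a \<in> carr Z \<Longrightarrow> b \<in> carr Z \<Longrightarrow> a + b \<in> carr Z"
      "\<And>a b. a \<in> carr Z \<Longrightarrow> b \<in> carr Z \<Longrightarrow> mul Z a b \<in> carr Z"
      "\<And>a. a \<in> carr Z \<Longrightarrow> - a \<in> carr Z"
      "\<And>a. a \<in> carr Z \<Longrightarrow> der Z a \<in> carr Z"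
      "\<And>a s. a \<in> carr Z \<Longrightarrow> scl Z s a \<in> carr Z"
  shows "poisson_vertex_algebra Z (pullback_bracket h (carr Z) lb)"
    and "pva_iso h Z (pullback_bracket h (carr Z) lb) A lb"
proof -
  interpret A: poisson_vertex_algebra A lb by fact
  let ?lb = "pullback_bracket h (carr Z) lb"
  have bij: "bij_betw h (carr Z) (carr A)" and h_unt: "h (unt Z) = unt A"
    and h_add: "\<And>a b. a \<in> carr Z \<Longrightarrow> b \<in> carr Z \<Longrightarrow> h (a + b) = h a + h b"
    and h_mul: "\<And>a b. a \<in> carr Z \<Longrightarrow> b \<in> carr Z \<Longrightarrow> h (mul Z a b) = mul A (h a) (h b)"
    and h_der: "\<And>a. a \<in> carr Z \<Longrightarrow> h (der Z a) = der A (h a)"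
    and h_scl: "\<And>a s. a \<in> carr Z \<Longrightarrow> h (scl Z s a) = scl A s (h a)"
    using iso by (auto simp: diffalg_iso_def)
  have inj: "inj_on h (carr Z)" and im: "h ` carr Z = carr A"
    using bij by (auto simp: bij_betw_def)
  have h_carr: "h a \<in> carr A" if "a \<in> carr Z" for a
    using im that by auto
  have h_0: "h 0 = 0" using h_add[OF Z(1) Z(1)] by simp
  have h_minus: "h (- a) = - h a" if "a \<in> carr Z" for a
    using h_add[OF that Z(5)[OF that]] by (simp add: h_0 eq_neg_iff_add_eq_0 add.commute)
  have h_diff: "a - b \<in> carr Z \<and> h (a - b) = h a - h b" if "a \<in> carr Z" "b \<in> carr Z" for a b
    using h_add[OF that(1) Z(5)[OF that(2)]] Z(3)[OF that(1) Z(5)[OF that(2)]] by (simp add: h_minus that)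
  have h_sum: "sum g I \<in> carr Z \<and> h (sum g I) = (\<Sum>i\<in>I. h (g i))"
    if "\<And>i. i \<in> I \<Longrightarrow> g i \<in> carr Z" for g and I :: "nat set"
    using that by (induction I rule: infinite_finite_induct) (auto simp: h_0 h_add Z)
  have h_dern: "(der Z ^^ k) a \<in> carr Z \<and> h ((der Z ^^ k) a) = (der A ^^ k) (h a)" if "a \<in> carr Z" for a k
    using that by (induction k) (auto simp: h_der Z)
  have lb_Z: "?lb a b k \<in> carr Z" and h_lb: "h (?lb a b k) = lb (h a) (h b) k"
    if "a \<in> carr Z" "b \<in> carr Z" for a b k
  proof -
    have "lb (h a) (h b) k \<in> h ` carr Z"
      unfolding im using that by (intro A.lb_closed h_carr)
    thus "?lb a b k \<in> carr Z" "h (?lb a b k) = lb (h a) (h b) k"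
      unfolding pullback_bracket_def
      using the_inv_into_into[OF inj] f_the_inv_into_f[OF inj] by auto
  qed
  have lb_0_iff: "?lb a b k = 0 \<longleftrightarrow> lb (h a) (h b) k = 0" if "a \<in> carr Z" "b \<in> carr Z" for a b k
    using inj_on_eq_iff[OF inj lb_Z[OF that] Z(1)] h_lb[OF that] by (simp add: h_0)
  note hs = h_unt h_add h_mul h_der h_scl h_minus h_lb h_carr lb_Z h_0 Z h_diff
  have eqI: "a = b" if "h a = h b" "a \<in> carr Z" "b \<in> carr Z" for a b
    using inj_onD[OF inj] that by blast
  show "poisson_vertex_algebra Z ?lb"
  proof unfold_locales
    fix a b c s t k l
    assume a: "a \<in> carr Z"
    show "scl Z (s + t) a = scl Z s a + scl Z t a"
      by (rule eqI) (simp_all add: hs a A.scl_add_left)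
    show "scl Z s (scl Z t a) = scl Z (s * t) a"
      by (rule eqI) (simp_all add: hs a A.scl_scl)
    show "scl Z 1 a = a"
      by (rule eqI) (simp_all add: hs a A.scl_one)
    show "mul Z (unt Z) a = a"
      by (rule eqI) (simp_all add: hs a A.mul_unt)
    show "der Z (scl Z s a) = scl Z s (der Z a)"
      by (rule eqI) (simp_all add: hs a A.der_scl)
    assume b: "b \<in> carr Z"
    show "scl Z s (a + b) = scl Z s a + scl Z s b"
      by (rule eqI) (simp_all add: hs a b A.scl_add_right)
    show "mul Z a b = mul Z b a"
      by (rule eqI) (simp_all add: hs a b A.mul_comm)
    show "mul Z a (scl Z s b) = scl Z s (mul Z a b)"
      by (rule eqI) (simp_all add: hs a b A.mul_scl)
    show "der Z (a + b) = der Z a + der Z b"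
      by (rule eqI) (simp_all add: hs a b A.der_add)
    show "der Z (mul Z a b) = mul Z (der Z a) b + mul Z a (der Z b)"
      by (rule eqI) (simp_all add: hs a b A.der_mul)
    show "finite {k. ?lb a b k \<noteq> 0}"
      using A.lb_finite[OF h_carr[OF a] h_carr[OF b]] by (simp add: lb_0_iff a b)
    show "?lb (scl Z s a) b k = scl Z s (?lb a b k)"
      by (rule eqI) (simp_all add: hs a b A.lb_scl_left)
    show "?lb a (scl Z s b) k = scl Z s (?lb a b k)"
      by (rule eqI) (simp_all add: hs a b A.lb_scl_right)
    show "?lb (der Z a) b k = (case k of 0 \<Rightarrow> 0 | Suc l \<Rightarrow> - ?lb a b l)"
      by (rule eqI) (simp_all add: hs a b A.lb_der_left split: nat.split)
    show "?lb a (der Z b) k = der Z (?lb a b k) + (case k of 0 \<Rightarrow> 0 | Suc l \<Rightarrow> ?lb a b l)"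
      by (rule eqI) (simp_all add: hs a b A.lb_der_right split: nat.split)
    let ?s = "\<lambda>l. scl Z ((-1) ^ l * of_nat (l choose k)) ((der Z ^^ (l - k)) (?lb a b l))"
    have s: "?s l \<in> carr Z" for l by (simp add: hs a b h_dern)
    show "?lb b a k = - (\<Sum>l | k \<le> l \<and> ?lb a b l \<noteq> 0. ?s l)"
    proof (rule eqI)
      show "h (?lb b a k) = h (- (\<Sum>l | k \<le> l \<and> ?lb a b l \<noteq> 0. ?s l))"
        using A.lb_skew[OF h_carr[OF a] h_carr[OF b], of k]
        by (simp add: hs a b h_sum s h_dern lb_0_iff)
    qed (simp_all add: hs a b h_sum s)
    assume c: "c \<in> carr Z"
    show "mul Z (mul Z a b) c = mul Z a (mul Z b c)"
      by (rule eqI) (simp_all add: hs a b c A.mul_assoc)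
    show "mul Z a (b + c) = mul Z a b + mul Z a c"
      by (rule eqI) (simp_all add: hs a b c A.mul_add)
    show "?lb a (mul Z b c) k = mul Z (?lb a b k) c + mul Z b (?lb a c k)"
      by (rule eqI) (simp_all add: hs a b c A.lb_leibniz)
    show "?lb a (b + c) k = ?lb a b k + ?lb a c k"
      by (rule eqI) (simp_all add: hs a b c A.lb_add_right)
    show "?lb a (?lb b c l) k - ?lb b (?lb a c k) l =
        (\<Sum>i\<le>k. scl Z (of_nat ((k + l - i) choose l)) (?lb (?lb a b i) c (k + l - i)))"
      by (rule eqI) (simp_all add: hs a b c h_sum A.lb_jacobi)
  next
    fix a a' b k assume "a \<in> carr Z" "a' \<in> carr Z" "b \<in> carr Z"
    thus "?lb (a + a') b k = ?lb a b k + ?lb a' b k"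
      by (intro eqI) (simp_all add: hs A.lb_add_left)
  qed (simp_all add: Z lb_Z)
  show "pva_iso h Z ?lb A lb"
    using iso by (simp add: pva_iso_def h_lb)
qed

text \<open>The center is the preimage under the injective map \<open>w\<close> of the image of \<open>FunOp n\<close> under \<open>j\<close>. Both maps are
  homomorphisms, so the center is closed under the operations and \<open>j\<^sup>-\<^sup>1 \<circ> w\<close> is an isomorphism on it.\<close>

lemma diffalg_iso_affine_HC:
  fixes V :: "'v::ab_group_add vsa" and W :: "'w::ab_group_add vsa"
  assumes w: "vsa_hom w V W" "inj w" and j: "pi0_embedding n W G j"
    and B: "differential_subalgebra (pi0 n) (FunOp n)" and im: "w ` vcenter V = j ` FunOp n"
  shows "diffalg_iso (affine_HC n j w) (center_alg V) (FunOp_alg n)"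
    and "0 \<in> vcenter V" and "vac V \<in> vcenter V"
    and "\<And>a b. a \<in> vcenter V \<Longrightarrow> b \<in> vcenter V \<Longrightarrow> a + b \<in> vcenter V \<and> prd V a (-1) b \<in> vcenter V"
    and "\<And>a c. a \<in> vcenter V \<Longrightarrow> - a \<in> vcenter V \<and> translation V a \<in> vcenter V \<and> vscl V c a \<in> vcenter V"
proof -
  let ?h = "affine_HC n j w"
  have sel [simp]: "scl (pi0 n) = lin_scale" "mul (pi0 n) = (*)" "unt (pi0 n) = 1" "der (pi0 n) = dpoly_der"
    by (simp_all add: pi0_def)
  have sub: "g \<in> carr (pi0 n)" if "g \<in> FunOp n" for g
    using B that by (auto simp: differential_subalgebra_def)
  have B': "0 \<in> FunOp n" "1 \<in> FunOp n"
    "g \<in> FunOp n \<Longrightarrow> g' \<in> FunOp n \<Longrightarrow> g + g' \<in> FunOp n"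
    "g \<in> FunOp n \<Longrightarrow> g' \<in> FunOp n \<Longrightarrow> g * g' \<in> FunOp n"
    "g \<in> FunOp n \<Longrightarrow> dpoly_der g \<in> FunOp n"
    "g \<in> FunOp n \<Longrightarrow> lin_scale c g \<in> FunOp n" for g g' c
    using B by (auto simp: differential_subalgebra_def)
  have j_inj: "inj_on j (carr (pi0 n))" and j_1: "j 1 = vac W"
    using j by (auto simp: pi0_embedding_def)
  have j_hom: "g \<in> FunOp n \<Longrightarrow> g' \<in> FunOp n \<Longrightarrow> j (g + g') = j g + j g'"
    "g \<in> FunOp n \<Longrightarrow> g' \<in> FunOp n \<Longrightarrow> j (g * g') = prd W (j g) (-1) (j g')"
    "g \<in> FunOp n \<Longrightarrow> j (dpoly_der g) = translation W (j g)"
    "g \<in> FunOp n \<Longrightarrow> j (lin_scale c g) = vscl W c (j g)" for g g' c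
    using j by (auto simp: pi0_embedding_def sub)
  have j_0: "j 0 = 0" using j_hom(1)[OF B'(1) B'(1)] by simp
  have w_hom: "w (a + b) = w a + w b" "w (prd V a m b) = prd W (w a) m (w b)"
    "w (vscl V c a) = vscl W c (w a)" "w (vac V) = vac W" for a b c m
    using w(1) by (auto simp: vsa_hom_def)
  have w_tr: "w (translation V a) = translation W (w a)" for a
    by (simp add: translation_def w_hom)
  have w_0: "w 0 = 0" using w_hom(1)[of 0 0] by simp
  have w_minus: "w (- a) = - w a" for a
    using w_hom(1)[of a "- a"] by (simp add: w_0 eq_neg_iff_add_eq_0 add.commute)
  have center: "a \<in> vcenter V" if "w a = j g" "g \<in> FunOp n" for a g
  proof -
    have "w a \<in> w ` vcenter V" using that im by auto
    thus ?thesis using w(2) by (simp add: inj_image_mem_iff)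
  qed
  have h: "?h a \<in> FunOp n \<and> j (?h a) = w a" if "a \<in> vcenter V" for a
  proof -
    have "w a \<in> j ` FunOp n" using im that by blast
    then obtain g where g: "g \<in> FunOp n" "w a = j g" by auto
    hence "?h a = g"
      by (simp add: affine_HC_def the_inv_into_f_f[OF j_inj] sub)
    thus ?thesis using g by simp
  qed
  have h_eqI: "?h a = g" if "w a = j g" "g \<in> FunOp n" for a g
    using that by (simp add: affine_HC_def the_inv_into_f_f[OF j_inj] sub)
  have hom_add: "w (a + b) = j (?h a + ?h b)" if "a \<in> vcenter V" "b \<in> vcenter V" for a b
    using h[OF that(1)] h[OF that(2)] by (simp add: w_hom j_hom)
  have hom_mul: "w (prd V a (-1) b) = j (?h a * ?h b)" if "a \<in> vcenter V" "b \<in> vcenter V" for a b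
    using h[OF that(1)] h[OF that(2)] by (simp add: w_hom j_hom)
  have hom_der: "w (translation V a) = j (dpoly_der (?h a))"
    and hom_scl: "w (vscl V c a) = j (lin_scale c (?h a))"
    and hom_minus: "w (- a) = j (- ?h a)" if "a \<in> vcenter V" for a c
  proof -
    show "w (translation V a) = j (dpoly_der (?h a))" "w (vscl V c a) = j (lin_scale c (?h a))"
      using h[OF that] by (simp_all add: w_hom w_tr j_hom)
    have "- ?h a \<in> FunOp n"
      using B'(6)[of "?h a" "-1"] h[OF that] by (simp add: lin_scale_minus1)
    moreover from this have "j (- ?h a) = - j (?h a)"
      using j_hom(1)[of "?h a" "- ?h a"] h[OF that] by (simp add: j_0 eq_neg_iff_add_eq_0 add.commute)
    ultimately show "w (- a) = j (- ?h a)"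
      using h[OF that] by (simp add: w_minus)
  qed
  have minus: "- g \<in> FunOp n" if "g \<in> FunOp n" for g
    using B'(6)[of g "-1"] that by (simp add: lin_scale_minus1)
  show "0 \<in> vcenter V" using center[of 0 0] by (simp add: w_0 j_0 B')
  show vac: "vac V \<in> vcenter V" using center[of "vac V" 1] by (simp add: w_hom j_1 B')
  show "a + b \<in> vcenter V \<and> prd V a (-1) b \<in> vcenter V" if "a \<in> vcenter V" "b \<in> vcenter V" for a b
    using center[OF hom_add[OF that]] center[OF hom_mul[OF that]] h[OF that(1)] h[OF that(2)]
    by (simp add: B')
  show "- a \<in> vcenter V \<and> translation V a \<in> vcenter V \<and> vscl V c a \<in> vcenter V"
    if "a \<in> vcenter V" for a c
    using center[OF hom_der[OF that]] center[OF hom_scl[OF that]] center[OF hom_minus[OF that]] h[OF that]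
    by (simp add: B' minus)
  have "bij_betw ?h (vcenter V) (FunOp n)"
  proof (rule bij_betw_imageI)
    show "inj_on ?h (vcenter V)"
      by (rule inj_onI) (metis h injD[OF w(2)])
    show "?h ` vcenter V = FunOp n"
    proof
      show "FunOp n \<subseteq> ?h ` vcenter V"
      proof
        fix g assume g: "g \<in> FunOp n"
        then obtain a where "a \<in> vcenter V" "w a = j g" using im by (metis imageE imageI)
        thus "g \<in> ?h ` vcenter V" using h_eqI[of a g] g by force
      qed
    qed (use h in auto)
  qed
  moreover have "?h (vac V) = 1" by (rule h_eqI) (simp_all add: w_hom j_1 B')
  ultimately show "diffalg_iso ?h (center_alg V) (FunOp_alg n)"
    unfolding diffalg_iso_def using h
    by (auto simp: center_alg_def FunOp_alg_def B'
        intro!: h_eqI hom_add hom_mul hom_der hom_scl)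
qed

theorem proposition6p5:
  fixes n :: nat and lb :: "dpoly \<Rightarrow> dpoly \<Rightarrow> nat \<Rightarrow> dpoly"
  assumes "n \<ge> 1"
    and "standard_pva n lb"
  shows "poisson_vertex_subalgebra (pi0 n) lb (FunOp n) \<and>
    (\<forall>(V :: 'v::ab_group_add vsa) J (W :: 'w::ab_group_add vsa) G j w.
       universal_affine_gl n (kappa_c n) V J \<and> free_field_vsa n W G \<and> pi0_embedding n W G j \<and>
       wakimoto n V J W G w \<and> w ` vcenter V = j ` FunOp n \<longrightarrow>
         (let hc = affine_HC n j w; lbz = pullback_bracket hc (vcenter V) lb
          in poisson_vertex_algebra (center_alg V) lbz \<and>
             pva_iso hc (center_alg V) lbz (FunOp_alg n) lb))"
proof (intro conjI allI impI)
  show sub: "poisson_vertex_subalgebra (pi0 n) lb (FunOp n)"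
    by (rule FunOp_poisson_vertex_subalgebra) fact
  fix V :: "'v vsa" and J and W :: "'w vsa" and G j w
  assume "universal_affine_gl n (kappa_c n) V J \<and> free_field_vsa n W G \<and> pi0_embedding n W G j \<and>
       wakimoto n V J W G w \<and> w ` vcenter V = j ` FunOp n"
  hence hyps: "vsa_hom w V W" "inj w" "pi0_embedding n W G j" "w ` vcenter V = j ` FunOp n"
    by (auto simp: wakimoto_def Let_def)
  have B: "differential_subalgebra (pi0 n) (FunOp n)"
    using sub by (simp add: poisson_vertex_subalgebra_def)
  note HC = diffalg_iso_affine_HC[OF hyps(1-3) B hyps(4)]
  have iso: "diffalg_iso (affine_HC n j w) (center_alg V) (FunOp_alg n)"
    and cl: "0 \<in> vcenter V" "vac V \<in> vcenter V"
      "\<And>a b. a \<in> vcenter V \<Longrightarrow> b \<in> vcenter V \<Longrightarrow> a + b \<in> vcenter V \<and> prd V a (-1) b \<in> vcenter V"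
      "\<And>a c. a \<in> vcenter V \<Longrightarrow> - a \<in> vcenter V \<and> translation V a \<in> vcenter V \<and> vscl V c a \<in> vcenter V"
    by (fact HC)+
  have pva: "poisson_vertex_algebra (FunOp_alg n) lb"
    unfolding FunOp_alg_def by (rule poisson_vertex_algebra_restrict) (rule sub)
  have carr: "carr (center_alg V) = vcenter V" by (simp add: center_alg_def)
  note pullback = poisson_vertex_algebra_pullback[OF pva iso]
  show "let hc = affine_HC n j w; lbz = pullback_bracket hc (vcenter V) lb
          in poisson_vertex_algebra (center_alg V) lbz \<and>
             pva_iso hc (center_alg V) lbz (FunOp_alg n) lb"
    unfolding Let_def carr[symmetric]
    by (intro conjI pullback) (use cl in \<open>simp_all add: center_alg_def\<close>)
qed

end
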